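(* Consider the mean-field sharing model with major and minor subsystems (MF-MM model) and its coordinated system, with $\mathcal{G}_{\mathit{MF-MM}}$, $J$, $\hat\ell_t$ and the conditional expectations given $(Z_t,X^0_t,\Gamma_t,U^0_t)$ as described in the context. Within the control strategies $\mathcal{G}_{\mathit{MF-MM}}$, there is no loss of optimality in restricting attention to Markovian strategies, i.e. strategies of the form $U^0_t=g^0_t(Z_t,X^0_t)$ and $U^i_t=g_t(Z_t,X^0_t,X^i_t)$. Furthermore, an optimal strategy $({\mathbf g^0}^\ast,\mathbf g^\ast)$, i.e. one minimizing $J$ over $\mathcal{G}_{\mathit{MF-MM}}$, is obtained by solving the following dynamic program. Define recursively value functions $V_{T+1}(z,x^0):=0$ for all $z,x^0$, and for $t=T,\ldots,1$, $$V_t(z_t,x^0_t):=\min_{\gamma_t,u^0_t}\Big(\hat\ell_t(z_t,x^0_t,\gamma_t,u^0_t)+\mathbb{E}\big[V_{t+1}(Z_{t+1},X^0_{t+1})\,\big|\,Z_t=z_t,X^0_t=x^0_t,\Gamma_t=\gamma_t,U^0_t=u^0_t\big]\Big),$$ where the minimum is over $\gamma_t:\mathcal{X}\to\mathcal{U}$ and $u^0_t\in\mathcal{U}^0$. Let $\psi^\ast_t(z_t,x^0_t)=\big(\psi^\ast_t(1)(z_t,x^0_t),\psi^\ast_t(2)(z_t,x^0_t)\big)$ denote an argmin $(\gamma^\ast_t,{u^0_t}^\ast)$ of the right-hand side. Define $g^\ast_t(z,x^0,x):=\psi^\ast_t(1)(z,x^0)(x)$ and ${g^0_t}^\ast(z,x^0):=\psi^\ast_t(2)(z,x^0)$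 for all $x,z,x^0$. Then the collection of strategies $\mathbf g^\ast=(g^\ast_1,\ldots,g^\ast_T)$ and ${\mathbf g^0}^\ast=({g^0_1}^\ast,\ldots,{g^0_T}^\ast)$ is optimal.
   Context: MF-MM model. Let $n,T\in\mathbb{N}$. There are $n$ minor subsystems and one major subsystem (index $0$). Minor subsystem $i\in\{1,\ldots,n\}$ has state $X^i_t\in\mathcal{X}$ and action $U^i_t\in\mathcal{U}$; the major subsystem has state $X^0_t\in\mathcal{X}^0$ and action $U^0_t\in\mathcal{U}^0$. The sets $\mathcal{X},\mathcal{U},\mathcal{X}^0,\mathcal{U}^0$ are finite. Write $\mathbf X_t=(X^1_t,\ldots,X^n_t)$, $\mathbf U_t=(U^1_t,\ldots,U^n_t)$, and $Y_{1:t}=(Y_1,\ldots,Y_t)$. The mean-field of the minor subsystems is the empirical distribution $Z_t=\frac1n\sum_{i=1}^n\delta_{X^i_t}$ ($\delta_x$ the Dirac measure at $x$); $z$ ranges over the finite set of empirical distributions of $n$ points of $\mathcal{X}$. Dynamics: $X^0_{t+1}=f^0_t(Z_t,X^0_t,U^0_t,W^0_t)$ and $X^i_{t+1}=f_t(Z_t,X^0_t,X^i_t,U^i_t,W^i_t)$ for $i\in\{1,\ldots,n\}$. The primitive random variables $X^0_1,X^1_1,\ldots,X^n_1$ and $W^i_t$ ($0\le i\le n$, $1\le t\le T$) are mutually independent. For the minor subsystems $i\in\{1,\ldots,n\}$, the dynamics $f_t$ and the distributions of $X^i_1$ and $W^i_t$ do not depend on $i$. Control: all minor controllers use the same control law;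 $U^0_t=g^0_t(Z_{1:t},X^0_{1:t})$ and $U^i_t=g_t(Z_{1:t},X^0_{1:t},X^i_t)$, $i\in\{1,\ldots,n\}$. A control strategy is a pair $(\mathbf g^0,\mathbf g)$ with $\mathbf g^0=(g^0_1,\ldots,g^0_T)$, $\mathbf g=(g_1,\ldots,g_T)$; $\mathcal{G}_{\mathit{MF-MM}}$ is the set of all such strategies. At time $t$ the system incurs a cost $\ell_t(\mathbf X_t,X^0_t,\mathbf U_t,U^0_t)\in\mathbb{R}$, with $\ell_t$ an arbitrary function. The expected total cost is $J(\mathbf g^0,\mathbf g)=\mathbb{E}\big[\sum_{t=1}^T\ell_t(\mathbf X_t,X^0_t,\mathbf U_t,U^0_t)\big]$, the expectation being with respect to the measure induced by the strategy. Coordinated system. A coordinator observes $(Z_{1:t},X^0_{1:t})$ and chooses $(\Gamma_t,U^0_t)=\psi_t(Z_{1:t},X^0_{1:t})$, where $\Gamma_t:\mathcal{X}\to\mathcal{U}$ is a prescription and $U^0_t\in\mathcal{U}^0$. Minor actions are generated by $U^i_t=\Gamma_t(X^i_t)$; the dynamics are $X^0_{t+1}=f^0_t(Z_t,X^0_t,U^0_t,W^0_t)$ and $X^i_{t+1}=f_t(Z_t,X^0_t,X^i_t,U^i_t,W^i_t)$ for $i\in\{1,\ldots,n\}$, with the same primitive random variables, and the cost incurred at time $t$ is $\ell_t(\mathbf X_t,X^0_t,\mathbf U_t,U^0_t)$. The sequence $\boldsymbol\psi=(\psi_1,\ldots,\psi_T)$ is a coordination strategy. The function $\hat\ell_t$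 is the one satisfying $\mathbb{E}[\ell_t(\mathbf X_t,X^0_t,\mathbf U_t,U^0_t)\mid Z_{1:t},X^0_{1:t},\Gamma_{1:t},U^0_{1:t}]=\hat\ell_t(Z_t,X^0_t,\Gamma_t,U^0_t)$ in the coordinated system under every coordination strategy; thus $\hat\ell_t(z,x^0,\gamma,u^0)=\mathbb{E}[\ell_t(\mathbf X_t,X^0_t,\mathbf U_t,U^0_t)\mid Z_t=z,X^0_t=x^0,\Gamma_t=\gamma,U^0_t=u^0]$. Conditional expectations given $\{Z_t=z,X^0_t=x^0,\Gamma_t=\gamma,U^0_t=u^0\}$ are taken in the coordinated system under any coordination strategy giving this event positive probability (the values do not depend on the choice); if no coordination strategy gives it positive probability, $\hat\ell_t(z,x^0,\gamma,u^0)$ is any fixed real number and the conditional law of $(Z_{t+1},X^0_{t+1})$ is any fixed probability distribution on the set of possible values. *)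

theory Defs
  imports "HOL-Probability.Probability"
begin

text \<open>
  The finite type \<open>'n\<close> indexes the minor subsystems, so \<open>CARD('n)\<close> is their number and joint minor
  states and actions are functions on \<open>'n\<close>. The sets of minor and major states and actions are
  the finite types \<open>'x\<close>, \<open>'u\<close>, \<open>'x0\<close>, \<open>'u0\<close>. The noises may live on arbitrary measurable spaces,
  which may vary with time.
\<close>

record ('n, 'x, 'u, 'x0, 'u0, 'd, 'd0, 'w) mf_mm =
  horizon :: nat
  sample :: "'w measure"
  init :: "'n \<Rightarrow> 'w \<Rightarrow> 'x"
  init0 :: "'w \<Rightarrow> 'x0"
  noise_space :: "nat \<Rightarrow> 'd measure"
  noise0_space :: "nat \<Rightarrow> 'd0 measure"
  noise :: "'n \<Rightarrow> nat \<Rightarrow> 'w \<Rightarrow> 'd"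
  noise0 :: "nat \<Rightarrow> 'w \<Rightarrow> 'd0"
  dyn :: "nat \<Rightarrow> 'x pmf \<Rightarrow> 'x0 \<Rightarrow> 'x \<Rightarrow> 'u \<Rightarrow> 'd \<Rightarrow> 'x"
  dyn0 :: "nat \<Rightarrow> 'x pmf \<Rightarrow> 'x0 \<Rightarrow> 'u0 \<Rightarrow> 'd0 \<Rightarrow> 'x0"
  cost :: "nat \<Rightarrow> ('n \<Rightarrow> 'x) \<Rightarrow> 'x0 \<Rightarrow> ('n \<Rightarrow> 'u) \<Rightarrow> 'u0 \<Rightarrow> real"

definition empirical :: "('n::finite \<Rightarrow> 'x) \<Rightarrow> 'x pmf" where
  "empirical x = map_pmf x (pmf_of_set UNIV)"

lemma pmf_empirical:
  fixes x :: "'n::finite \<Rightarrow> 'x"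
  shows "pmf (empirical x) a = real (card {i. x i = a}) / real CARD('n)"
proof -
  have "pmf (empirical x) a = measure (pmf_of_set (UNIV :: 'n set)) (x -` {a})"
    by (simp add: empirical_def pmf_map)
  also have "\<dots> = real (card {i. x i = a}) / real CARD('n)"
    by (simp add: measure_pmf_of_set vimage_def)
  finally show ?thesis .
qed


subsection \<open>Primitive random variables\<close>

text \<open>
  The primitive random variables have different types, so \<^const>\<open>prob_space.indep_vars\<close> does not
  apply to them directly. As in its definition, their mutual independence is that of the families
  of events they generate.
\<close>

datatype 'n primitive = Init 'n | Init0 | Noise 'n nat | Noise0 nat

definition generated_events :: "'w measure \<Rightarrow> 'b measure \<Rightarrow> ('w \<Rightarrow> 'b) \<Rightarrow> 'w set set" where
  "generated_events M N Y = {Y -` A \<inter> space M | A. A \<in> sets N}"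

primrec primitive_events ::
    "('n, 'x, 'u, 'x0, 'u0, 'd, 'd0, 'w) mf_mm \<Rightarrow> 'n primitive \<Rightarrow> 'w set set" where
  "primitive_events m (Init i) = generated_events (sample m) (count_space UNIV) (init m i)"
| "primitive_events m Init0 = generated_events (sample m) (count_space UNIV) (init0 m)"
| "primitive_events m (Noise i t) = generated_events (sample m) (noise_space m t) (noise m i t)"
| "primitive_events m (Noise0 t) = generated_events (sample m) (noise0_space m t) (noise0 m t)"

locale mf_mm_model = prob_space "sample m"
  for m :: "('n::finite, 'x::finite, 'u::finite, 'x0::finite, 'u0::finite, 'd, 'd0, 'w) mf_mm" +
  assumes init_measurable: "init m i \<in> measurable (sample m) (count_space UNIV)"
    and init0_measurable: "init0 m \<in> measurable (sample m) (count_space UNIV)"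
    and noise_measurable:
      "t \<in> {1..horizon m} \<Longrightarrow> noise m i t \<in> measurable (sample m) (noise_space m t)"
    and noise0_measurable:
      "t \<in> {1..horizon m} \<Longrightarrow> noise0 m t \<in> measurable (sample m) (noise0_space m t)"
    and dyn_measurable: "t \<in> {1..horizon m} \<Longrightarrow> z \<in> range (empirical :: ('n \<Rightarrow> 'x) \<Rightarrow> 'x pmf) \<Longrightarrow>
      dyn m t z x0 x u \<in> measurable (noise_space m t) (count_space UNIV)"
    and dyn0_measurable: "t \<in> {1..horizon m} \<Longrightarrow> z \<in> range (empirical :: ('n \<Rightarrow> 'x) \<Rightarrow> 'x pmf) \<Longrightarrow>
      dyn0 m t z x0 u0 \<in> measurable (noise0_space m t) (count_space UNIV)"
    and primitive_indep: "indep_sets (primitive_events m)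
      (range Init \<union> {Init0} \<union> {Noise i t | i t. t \<in> {1..horizon m}} \<union> Noise0 ` {1..horizon m})"
    and init_ident: "distr (sample m) (count_space UNIV) (init m i) =
      distr (sample m) (count_space UNIV) (init m j)"
    and noise_ident: "t \<in> {1..horizon m} \<Longrightarrow>
      distr (sample m) (noise_space m t) (noise m i t) =
      distr (sample m) (noise_space m t) (noise m j t)"


subsection \<open>Closed-loop processes\<close>

text \<open>
  An action rule gives the joint minor action and the major action at time \<open>t\<close> from
  \<open>[Z\<^sub>1, \<dots>, Z\<^sub>t]\<close>, \<open>[X\<^sup>0\<^sub>1, \<dots>, X\<^sup>0\<^sub>t]\<close> and the joint minor state at time \<open>t\<close>. Control strategies
  and coordination strategies are run through the same dynamics via their action rules.
  \<open>history m a \<omega> t\<close> lists the pairs of joint minor state and major state at times \<open>1, \<dots>, t\<close>;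
  time starts at 1.
\<close>

type_synonym ('n, 'x, 'u, 'x0, 'u0) action_rule =
  "nat \<Rightarrow> 'x pmf list \<Rightarrow> 'x0 list \<Rightarrow> ('n \<Rightarrow> 'x) \<Rightarrow> ('n \<Rightarrow> 'u) \<times> 'u0"

primrec history :: "('n::finite, 'x, 'u, 'x0, 'u0, 'd, 'd0, 'w) mf_mm \<Rightarrow>
    ('n, 'x, 'u, 'x0, 'u0) action_rule \<Rightarrow> 'w \<Rightarrow> nat \<Rightarrow> (('n \<Rightarrow> 'x) \<times> 'x0) list" where
  "history m a \<omega> 0 = []"
| "history m a \<omega> (Suc t) =
    (if t = 0 then [(\<lambda>i. init m i \<omega>, init0 m \<omega>)]
     else let h = history m a \<omega> t;
              (x, x0) = last h;
              z = empirical x;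
              (u, u0) = a t (map (empirical \<circ> fst) h) (map snd h) x
          in h @ [(\<lambda>i. dyn m t z x0 (x i) (u i) (noise m i t \<omega>),
                   dyn0 m t z x0 u0 (noise0 m t \<omega>))])"

context
  fixes m :: "('n::finite, 'x, 'u, 'x0, 'u0, 'd, 'd0, 'w) mf_mm"
    and a :: "('n, 'x, 'u, 'x0, 'u0) action_rule"
begin

definition X :: "nat \<Rightarrow> 'w \<Rightarrow> 'n \<Rightarrow> 'x" where
  "X t \<omega> = fst (last (history m a \<omega> t))"

definition X0 :: "nat \<Rightarrow> 'w \<Rightarrow> 'x0" where
  "X0 t \<omega> = snd (last (history m a \<omega> t))"

definition Z :: "nat \<Rightarrow> 'w \<Rightarrow> 'x pmf" where
  "Z t \<omega> = empirical (X t \<omega>)"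

definition Zs :: "nat \<Rightarrow> 'w \<Rightarrow> 'x pmf list" where
  "Zs t \<omega> = map (\<lambda>s. Z s \<omega>) [1..<Suc t]"

definition X0s :: "nat \<Rightarrow> 'w \<Rightarrow> 'x0 list" where
  "X0s t \<omega> = map (\<lambda>s. X0 s \<omega>) [1..<Suc t]"

definition U :: "nat \<Rightarrow> 'w \<Rightarrow> 'n \<Rightarrow> 'u" where
  "U t \<omega> = fst (a t (Zs t \<omega>) (X0s t \<omega>) (X t \<omega>))"

definition U0 :: "nat \<Rightarrow> 'w \<Rightarrow> 'u0" where
  "U0 t \<omega> = snd (a t (Zs t \<omega>) (X0s t \<omega>) (X t \<omega>))"

definition stage_cost :: "nat \<Rightarrow> 'w \<Rightarrow> real" where
  "stage_cost t \<omega> = cost m t (X t \<omega>) (X0 t \<omega>) (U t \<omega>) (U0 t \<omega>)"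

lemma history_eq: "history m a \<omega> t = map (\<lambda>s. (X s \<omega>, X0 s \<omega>)) [1..<Suc t]"
proof (induction t)
  case (Suc t)
  have "history m a \<omega> (Suc t) = history m a \<omega> t @ [last (history m a \<omega> (Suc t))]"
    by (simp add: Let_def split: prod.splits)
  then show ?case
    using Suc.IH by (simp add: X_def X0_def)
qed simp

lemma state_equations:
  shows "X (Suc 0) \<omega> i = init m i \<omega>"
    and "X0 (Suc 0) \<omega> = init0 m \<omega>"
    and "t \<ge> 1 \<Longrightarrow> X (Suc t) \<omega> i =
      dyn m t (Z t \<omega>) (X0 t \<omega>) (X t \<omega> i) (U t \<omega> i) (noise m i t \<omega>)"
    and "t \<ge> 1 \<Longrightarrow> X0 (Suc t) \<omega> = dyn0 m t (Z t \<omega>) (X0 t \<omega>) (U0 t \<omega>) (noise0 m t \<omega>)"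
proof -
  have zs: "map (empirical \<circ> fst) (history m a \<omega> t) = Zs t \<omega>"
    and xs: "map snd (history m a \<omega> t) = X0s t \<omega>"
    by (auto simp: history_eq Zs_def X0s_def Z_def)
  show "X (Suc 0) \<omega> i = init m i \<omega>" "X0 (Suc 0) \<omega> = init0 m \<omega>"
    by (simp_all add: X_def X0_def)
  have "last (history m a \<omega> (Suc t)) =
      (\<lambda>i. dyn m t (Z t \<omega>) (X0 t \<omega>) (X t \<omega> i) (U t \<omega> i) (noise m i t \<omega>),
       dyn0 m t (Z t \<omega>) (X0 t \<omega>) (U0 t \<omega>) (noise0 m t \<omega>))" if "t \<ge> 1"
    using that zs xs
    by (auto simp: Let_def Z_def U_def U0_def X_def X0_def split: prod.splits)
  then show "t \<ge> 1 \<Longrightarrow> X (Suc t) \<omega> i =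
      dyn m t (Z t \<omega>) (X0 t \<omega>) (X t \<omega> i) (U t \<omega> i) (noise m i t \<omega>)"
    and "t \<ge> 1 \<Longrightarrow> X0 (Suc t) \<omega> = dyn0 m t (Z t \<omega>) (X0 t \<omega>) (U0 t \<omega>) (noise0 m t \<omega>)"
    by (simp_all add: X_def[of "Suc t"] X0_def[of "Suc t"] del: history.simps)
qed

end


subsection \<open>Control strategies\<close>

text \<open>
  Every pair of functions is a control strategy: all spaces involved are finite, and only the
  values at times \<open>1 \<le> t \<le> T\<close> on histories of length \<open>t\<close> matter.
\<close>

type_synonym ('x, 'u, 'x0, 'u0) control_strategy =
  "(nat \<Rightarrow> 'x pmf list \<Rightarrow> 'x0 list \<Rightarrow> 'u0) \<times> (nat \<Rightarrow> 'x pmf list \<Rightarrow> 'x0 list \<Rightarrow> 'x \<Rightarrow> 'u)"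

definition control_rule ::
    "('x, 'u, 'x0, 'u0) control_strategy \<Rightarrow> ('n, 'x, 'u, 'x0, 'u0) action_rule" where
  "control_rule = (\<lambda>(g0, g) t zs x0s x. (\<lambda>i. g t zs x0s (x i), g0 t zs x0s))"

definition J :: "('n::finite, 'x, 'u, 'x0, 'u0, 'd, 'd0, 'w) mf_mm \<Rightarrow>
    ('x, 'u, 'x0, 'u0) control_strategy \<Rightarrow> real" where
  "J m \<sigma> = (\<integral>\<omega>. (\<Sum>t = 1..horizon m. stage_cost m (control_rule \<sigma>) t \<omega>) \<partial>sample m)"

definition optimal :: "('n::finite, 'x, 'u, 'x0, 'u0, 'd, 'd0, 'w) mf_mm \<Rightarrow>
    ('x, 'u, 'x0, 'u0) control_strategy \<Rightarrow> bool" where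
  "optimal m \<sigma> \<longleftrightarrow> (\<forall>\<sigma>'. J m \<sigma> \<le> J m \<sigma>')"

definition markov_strategy :: "(nat \<Rightarrow> 'x pmf \<Rightarrow> 'x0 \<Rightarrow> 'u0) \<Rightarrow>
    (nat \<Rightarrow> 'x pmf \<Rightarrow> 'x0 \<Rightarrow> 'x \<Rightarrow> 'u) \<Rightarrow> ('x, 'u, 'x0, 'u0) control_strategy" where
  "markov_strategy g0 g =
    (\<lambda>t zs x0s. g0 t (last zs) (last x0s), \<lambda>t zs x0s x. g t (last zs) (last x0s) x)"


subsection \<open>The coordinated system\<close>

type_synonym ('x, 'u, 'x0, 'u0) coordination_strategy =
  "nat \<Rightarrow> 'x pmf list \<Rightarrow> 'x0 list \<Rightarrow> ('x \<Rightarrow> 'u) \<times> 'u0"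

definition coordination_rule ::
    "('x, 'u, 'x0, 'u0) coordination_strategy \<Rightarrow> ('n, 'x, 'u, 'x0, 'u0) action_rule" where
  "coordination_rule \<psi> t zs x0s x = (let (\<gamma>, u0) = \<psi> t zs x0s in (\<lambda>i. \<gamma> (x i), u0))"

definition \<Gamma> :: "('n::finite, 'x, 'u, 'x0, 'u0, 'd, 'd0, 'w) mf_mm \<Rightarrow>
    ('x, 'u, 'x0, 'u0) coordination_strategy \<Rightarrow> nat \<Rightarrow> 'w \<Rightarrow> 'x \<Rightarrow> 'u" where
  "\<Gamma> m \<psi> t \<omega> =
    fst (\<psi> t (Zs m (coordination_rule \<psi>) t \<omega>) (X0s m (coordination_rule \<psi>) t \<omega>))"

definition info_event :: "('n::finite, 'x, 'u, 'x0, 'u0, 'd, 'd0, 'w) mf_mm \<Rightarrow>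
    ('x, 'u, 'x0, 'u0) coordination_strategy \<Rightarrow> nat \<Rightarrow>
    'x pmf \<Rightarrow> 'x0 \<Rightarrow> ('x \<Rightarrow> 'u) \<Rightarrow> 'u0 \<Rightarrow> 'w set" where
  "info_event m \<psi> t z x0 \<gamma> u0 = {\<omega> \<in> space (sample m).
    Z m (coordination_rule \<psi>) t \<omega> = z \<and> X0 m (coordination_rule \<psi>) t \<omega> = x0 \<and>
    \<Gamma> m \<psi> t \<omega> = \<gamma> \<and> U0 m (coordination_rule \<psi>) t \<omega> = u0}"

definition realizing_strategies :: "('n::finite, 'x, 'u, 'x0, 'u0, 'd, 'd0, 'w) mf_mm \<Rightarrow>
    nat \<Rightarrow> 'x pmf \<Rightarrow> 'x0 \<Rightarrow> ('x \<Rightarrow> 'u) \<Rightarrow> 'u0 \<Rightarrow> ('x, 'u, 'x0, 'u0) coordination_strategy set" where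
  "realizing_strategies m t z x0 \<gamma> u0 =
    {\<psi>. measure (sample m) (info_event m \<psi> t z x0 \<gamma> u0) > 0}"

text \<open>
  \<^const>\<open>uniform_measure\<close> \<open>M A\<close> is the conditional measure of \<open>M\<close> given the event \<open>A\<close>.

  A conditional cost or law is required to come from some realizing strategy, not from all of
  them: such functions then exist by construction, and the independence of the strategy is not
  built into the hypotheses. At tuples without realizing strategy the value is arbitrary.
\<close>

definition conditional_cost :: "('n::finite, 'x, 'u, 'x0, 'u0, 'd, 'd0, 'w) mf_mm \<Rightarrow>
    (nat \<Rightarrow> 'x pmf \<Rightarrow> 'x0 \<Rightarrow> ('x \<Rightarrow> 'u) \<Rightarrow> 'u0 \<Rightarrow> real) \<Rightarrow> bool" where
  "conditional_cost m l \<longleftrightarrow> (\<forall>t \<in> {1..horizon m}. \<forall>z x0 \<gamma> u0.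
    realizing_strategies m t z x0 \<gamma> u0 \<noteq> {} \<longrightarrow>
    (\<exists>\<psi> \<in> realizing_strategies m t z x0 \<gamma> u0. l t z x0 \<gamma> u0 =
      (\<integral>\<omega>. stage_cost m (coordination_rule \<psi>) t \<omega>
        \<partial>uniform_measure (sample m) (info_event m \<psi> t z x0 \<gamma> u0))))"

definition conditional_law :: "('n::finite, 'x, 'u, 'x0, 'u0, 'd, 'd0, 'w) mf_mm \<Rightarrow>
    (nat \<Rightarrow> 'x pmf \<Rightarrow> 'x0 \<Rightarrow> ('x \<Rightarrow> 'u) \<Rightarrow> 'u0 \<Rightarrow> ('x pmf \<times> 'x0) pmf) \<Rightarrow> bool" where
  "conditional_law m K \<longleftrightarrow> (\<forall>t \<in> {1..horizon m}. \<forall>z x0 \<gamma> u0.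
    if realizing_strategies m t z x0 \<gamma> u0 \<noteq> {}
    then \<exists>\<psi> \<in> realizing_strategies m t z x0 \<gamma> u0. measure_pmf (K t z x0 \<gamma> u0) =
      distr (uniform_measure (sample m) (info_event m \<psi> t z x0 \<gamma> u0)) (count_space UNIV)
        (\<lambda>\<omega>. (Z m (coordination_rule \<psi>) (Suc t) \<omega>, X0 m (coordination_rule \<psi>) (Suc t) \<omega>))
    else set_pmf (K t z x0 \<gamma> u0) \<subseteq> range (empirical :: ('n \<Rightarrow> 'x) \<Rightarrow> 'x pmf) \<times> UNIV)"


subsection \<open>The dynamic program\<close>

definition bellman_rhs :: "(nat \<Rightarrow> 'x pmf \<Rightarrow> 'x0 \<Rightarrow> ('x \<Rightarrow> 'u) \<Rightarrow> 'u0 \<Rightarrow> real) \<Rightarrow>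
    (nat \<Rightarrow> 'x pmf \<Rightarrow> 'x0 \<Rightarrow> ('x \<Rightarrow> 'u) \<Rightarrow> 'u0 \<Rightarrow> ('x pmf \<times> 'x0) pmf) \<Rightarrow>
    ('x pmf \<Rightarrow> 'x0 \<Rightarrow> real) \<Rightarrow> nat \<Rightarrow> 'x pmf \<Rightarrow> 'x0 \<Rightarrow> ('x \<Rightarrow> 'u) \<times> 'u0 \<Rightarrow> real" where
  "bellman_rhs l K v t z x0 = (\<lambda>(\<gamma>, u0). l t z x0 \<gamma> u0 +
    measure_pmf.expectation (K t z x0 \<gamma> u0) (\<lambda>(z', x0'). v z' x0'))"

function V :: "nat \<Rightarrow> (nat \<Rightarrow> 'x::finite pmf \<Rightarrow> 'x0 \<Rightarrow> ('x \<Rightarrow> 'u::finite) \<Rightarrow> 'u0::finite \<Rightarrow> real) \<Rightarrow>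
    (nat \<Rightarrow> 'x pmf \<Rightarrow> 'x0 \<Rightarrow> ('x \<Rightarrow> 'u) \<Rightarrow> 'u0 \<Rightarrow> ('x pmf \<times> 'x0) pmf) \<Rightarrow>
    nat \<Rightarrow> 'x pmf \<Rightarrow> 'x0 \<Rightarrow> real" where
  "V T l K t z x0 =
    (if t > T then 0 else Min (range (bellman_rhs l K (V T l K (Suc t)) t z x0)))"
  by pat_completeness auto
termination
  by (relation "Wellfounded.measure (\<lambda>(T, l, K, t, z, x0). Suc T - t)") auto

declare V.simps [simp del]

end

theory Submission
  imports Defs
begin

text \<open>
  Why Markovian strategies suffice. A control strategy and the coordination strategy that issues
  the corresponding prescriptions produce the same action rule, so everything happens in the
  coordinated system. There the minor subsystems are exchangeable: they start identically
  distributed, have identically distributed noises, and are told the same prescription, which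
  depends on the common information only. Permuting the minor subsystems in a history
  \<open>h\<close> leaves the common information \<open>(Z\<^sub>1\<^sub>:\<^sub>t, X\<^sup>0\<^sub>1\<^sub>:\<^sub>t)\<close> unchanged, and by
  \<open>history_exchangeable\<close> it also leaves the probability of \<open>h\<close> unchanged.

  Two joint states have the same empirical distribution iff they differ by a permutation. Hence,
  on the event \<open>{Z\<^sub>t = z, X\<^sup>0\<^sub>t = x\<^sup>0, \<Gamma>\<^sub>t = \<gamma>, U\<^sup>0\<^sub>t = u\<^sup>0}\<close>, the joint state is uniformly
  distributed on the set of joint states with empirical distribution \<open>z\<close>
  (\<open>prob_info_state_uniform\<close>), whatever the strategy. The noises at time \<open>t\<close> are independent of
  the history, so the conditional law of \<open>(X\<^sub>t, X\<^sub>t\<^sub>+\<^sub>1, X\<^sup>0\<^sub>t\<^sub>+\<^sub>1)\<close> on that event is one fixed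
  function of \<open>(z, x\<^sup>0, \<gamma>, u\<^sup>0)\<close>, here \<open>step_law\<close> (\<open>prob_info_step\<close>). In particular a
  conditional cost and a conditional transition law read off one strategy are valid for all.

  What remains is the dynamic programming argument. Summing over the finitely many events above
  gives, for every coordination strategy and every function \<open>v\<close> (\<open>bellman_step\<close>),
  that the expected stage cost plus the expectation of \<open>v (Z\<^sub>t\<^sub>+\<^sub>1, X\<^sup>0\<^sub>t\<^sub>+\<^sub>1)\<close> is the expectation of
  the Bellman right-hand side at \<open>(Z\<^sub>t, X\<^sup>0\<^sub>t, \<Gamma>\<^sub>t, U\<^sup>0\<^sub>t)\<close>. With \<open>v = V\<^sub>t\<^sub>+\<^sub>1\<close> the latter is at least
  the expectation of \<open>V\<^sub>t (Z\<^sub>t, X\<^sup>0\<^sub>t)\<close>, with equality if the strategy plays minimizers.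
  Downward induction on \<open>t\<close> bounds every cost from below by the expectation of
  \<open>V\<^sub>1 (Z\<^sub>1, X\<^sup>0\<^sub>1)\<close>, which depends on no strategy and is attained by the minimizing
  Markovian one. Tuples that a strategy reaches with probability 0 carry no weight in these sums,
  so the arbitrary values of the conditional cost and law there do no harm.
\<close>

section \<open>Permuting the minor subsystems\<close>

definition permute_history ::
    "('n \<Rightarrow> 'n) \<Rightarrow> (('n \<Rightarrow> 'x) \<times> 'x0) list \<Rightarrow> (('n \<Rightarrow> 'x) \<times> 'x0) list" where
  "permute_history \<pi> = map (apfst (\<lambda>x. x \<circ> \<pi>))"

lemma empirical_permute:
  fixes x :: "'n::finite \<Rightarrow> 'x" and \<pi> :: "'n \<Rightarrow> 'n"
  assumes "bij \<pi>"
  shows "empirical (x \<circ> \<pi>) = empirical x"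
proof -
  have "map_pmf \<pi> (pmf_of_set (UNIV :: 'n set)) = pmf_of_set UNIV"
    using map_pmf_of_set_inj[of \<pi> UNIV] assms by (simp add: bij_def)
  then show ?thesis
    by (simp add: empirical_def flip: pmf.map_comp)
qed

text \<open>
  The empirical distribution determines how often each state occurs, hence the multiset of the
  individual states, and two families with the same multiset of values are rearrangements of each
  other.
\<close>

lemma empirical_eq_imp_permute:
  fixes x y :: "'n::finite \<Rightarrow> 'x"
  assumes "empirical x = empirical y"
  obtains \<pi> where "bij \<pi>" "y = x \<circ> \<pi>"
proof -
  have "card {i. y i = a} = card {i. x i = a}" for a
    using pmf_empirical[of x a] pmf_empirical[of y a] assms by simp
  then have "image_mset y (mset_set UNIV) = image_mset x (mset_set UNIV)"
    by (intro multiset_eqI) (simp add: count_image_mset' eq_commute[of _ "x _"] eq_commute[of _ "y _"])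
  then obtain \<pi> where "\<pi> permutes UNIV" "\<forall>i\<in>UNIV. y i = x (\<pi> i)"
    by (rule image_mset_eq_implies_permutes[rotated]) simp_all
  then show ?thesis
    by (intro that[of \<pi>]) (auto intro: permutes_bij)
qed

lemma map_empirical_permute_history:
  assumes "bij (\<pi> :: 'n::finite \<Rightarrow> 'n)"
  shows "map (empirical \<circ> fst) (permute_history \<pi> h) = map (empirical \<circ> fst) h"
  by (induction h) (auto simp: permute_history_def empirical_permute[OF assms])

lemma map_snd_permute_history [simp]: "map snd (permute_history \<pi> h) = map snd h"
  by (induction h) (auto simp: permute_history_def)

lemma length_permute_history [simp]: "length (permute_history \<pi> h) = length h"
  by (simp add: permute_history_def)

lemma inj_permute_history:
  assumes "bij \<pi>"
  shows "inj (permute_history \<pi>)"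
proof -
  have "inj (\<lambda>x. x \<circ> \<pi>)"
    using assms by (intro injI) (metis bij_is_surj comp_assoc comp_id surj_iff)
  then have "inj (apfst (\<lambda>x. x \<circ> \<pi>))"
    by (auto simp: inj_def apfst_def map_prod_def split: prod.splits)
  then show ?thesis
    unfolding permute_history_def by (rule inj_mapI)
qed

lemma permute_history_inverse:
  assumes "bij \<pi>"
  shows "permute_history \<pi> (permute_history (inv \<pi>) h) = h"
  using assms
  by (induction h) (auto simp: permute_history_def o_assoc[symmetric] bij_is_inj inv_o_cancel)

section \<open>The law of the history\<close>

text \<open>
  The primitive random variables that determine the states at times \<open>1, \<dots>, t\<close>: the noises at
  time \<open>t\<close> enter only at time \<open>t + 1\<close>.
\<close>

definition primitives_before :: "nat \<Rightarrow> 'n primitive set" where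
  "primitives_before t =
    range Init \<union> {Init0} \<union> {Noise i s | i s. s \<in> {1..<t}} \<union> Noise0 ` {1..<t}"

lemma primitives_before_Suc:
  assumes "1 \<le> t"
  shows "primitives_before (Suc t) =
    primitives_before t \<union> (range (\<lambda>i. Noise i t) \<union> {Noise0 t})"
  using assms by (auto simp: primitives_before_def less_Suc_eq image_iff)

lemma finite_primitives_before [simp]: "finite (primitives_before t :: 'n::finite primitive set)"
proof -
  have "{Noise i s | (i :: 'n) s. s \<in> {1..<t}} = (\<lambda>(i, s). Noise i s) ` (UNIV \<times> {1..<t})"
    by auto
  then show ?thesis
    by (simp add: primitives_before_def)
qed

lemma finite_lists_of_length: "finite {h :: 'a::finite list. length h = t}"
  using finite_lists_length_eq[of "UNIV :: 'a set" t] by simp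

lemma length_history [simp]: "length (history m a \<omega> t) = t"
  by (simp add: history_eq)

lemma Zs_X0s_eq_history:
  "Zs m a t \<omega> = map (empirical \<circ> fst) (history m a \<omega> t)"
  "X0s m a t \<omega> = map snd (history m a \<omega> t)"
  by (auto simp: history_eq Zs_def X0s_def Z_def)

lemma generated_eventsI:
  "A \<in> sets N \<Longrightarrow> B = Y -` A \<inter> space M \<Longrightarrow> B \<in> generated_events M N Y"
  unfolding generated_events_def by blast

lemma primitives_before_nonempty: "primitives_before t \<noteq> {}"
  by (simp add: primitives_before_def)

context mf_mm_model
begin

text \<open>
  A transition of the joint state prescribes the outcome of each individual transition, so each
  of the events below constrains a single primitive random variable.
\<close>

definition noise_event where
  "noise_event t x x0 u x' i =
    {\<omega> \<in> space (sample m). dyn m t (empirical x) x0 (x i) (u i) (noise m i t \<omega>) = x' i}"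

definition noise0_event ::
    "nat \<Rightarrow> ('n \<Rightarrow> 'x) \<Rightarrow> 'x0 \<Rightarrow> 'u0 \<Rightarrow> 'x0 \<Rightarrow> 'w set" where
  "noise0_event t x x0 u0 x0' =
    {\<omega> \<in> space (sample m). dyn0 m t (empirical x) x0 u0 (noise0 m t \<omega>) = x0'}"

definition history_event where
  "history_event a t h = {\<omega> \<in> space (sample m). history m a \<omega> t = h}"

definition trans_prob where
  "trans_prob t x x0 u u0 x' x0' =
    (\<Prod>i\<in>UNIV. prob (noise_event t x x0 u x' i)) * prob (noise0_event t x x0 u0 x0')"

definition init_prob where
  "init_prob x x0 =
    (\<Prod>i\<in>UNIV. prob {\<omega> \<in> space (sample m). init m i \<omega> = x i}) *
    prob {\<omega> \<in> space (sample m). init0 m \<omega> = x0}"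

text \<open>
  Fixing the whole history fixes all past actions. The event that the history equals \<open>h\<close> is then
  an intersection of events, one for each primitive random variable, which is exactly the form
  that mutual independence speaks about. \<open>E\<close> is such a family of events. This avoids any
  detour through the sigma-algebra generated by the past.
\<close>

definition rectangle where
  "rectangle a t h E \<longleftrightarrow> (\<forall>j\<in>primitives_before t. E j \<in> primitive_events m j) \<and>
    history_event a t h = (\<Inter>j\<in>primitives_before t. E j)"

lemma noise_event_primitive:
  assumes "t \<in> {1..horizon m}"
  shows "noise_event t x x0 u x' i \<in> primitive_events m (Noise i t)"
    and "noise_event t x x0 u x' i =
      noise m i t -` (dyn m t (empirical x) x0 (x i) (u i) -` {x' i} \<inter> space (noise_space m t)) \<inter>
        space (sample m)"
    and "dyn m t (empirical x) x0 (x i) (u i) -` {x' i} \<inter> space (noise_space m t)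
      \<in> sets (noise_space m t)"
proof -
  let ?A = "dyn m t (empirical x) x0 (x i) (u i) -` {x' i} \<inter> space (noise_space m t)"
  show A: "?A \<in> sets (noise_space m t)"
    by (rule measurable_sets[OF dyn_measurable]) (use assms in auto)
  show eq: "noise_event t x x0 u x' i = noise m i t -` ?A \<inter> space (sample m)"
    using measurable_space[OF noise_measurable[OF assms]] by (auto simp: noise_event_def)
  show "noise_event t x x0 u x' i \<in> primitive_events m (Noise i t)"
    unfolding primitive_events.simps by (rule generated_eventsI[OF A eq])
qed

lemma noise0_event_primitive:
  assumes "t \<in> {1..horizon m}"
  shows "noise0_event t x x0 u0 x0' \<in> primitive_events m (Noise0 t)"
proof -
  let ?A = "dyn0 m t (empirical x) x0 u0 -` {x0'} \<inter> space (noise0_space m t)"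
  have "?A \<in> sets (noise0_space m t)"
    by (rule measurable_sets[OF dyn0_measurable]) (use assms in auto)
  moreover have "noise0_event t x x0 u0 x0' = noise0 m t -` ?A \<inter> space (sample m)"
    using measurable_space[OF noise0_measurable[OF assms]] by (auto simp: noise0_event_def)
  ultimately show ?thesis
    unfolding primitive_events.simps by (rule generated_eventsI)
qed

lemma primitive_index_subset:
  assumes "t \<le> Suc (horizon m)"
  shows "primitives_before t \<subseteq> range Init \<union> {Init0} \<union>
    {Noise i t | i t. t \<in> {1..horizon m}} \<union> Noise0 ` {1..horizon m}"
  using assms by (auto simp: primitives_before_def)

lemma prob_rectangle:
  assumes "rectangle a t h E" "t \<le> Suc (horizon m)"
  shows "prob (history_event a t h) = (\<Prod>j\<in>primitives_before t. prob (E j))"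
  using assms indep_setsD[OF primitive_indep primitive_index_subset[OF assms(2)], of E]
  by (auto simp: rectangle_def primitives_before_nonempty)

text \<open>
  At time 1 no noise has entered; the value of the family at noise indices is a dummy.
\<close>

lemma rectangle_init:
  "rectangle a 1 [(x, x0)] (\<lambda>j. case j of
      Init i \<Rightarrow> {\<omega> \<in> space (sample m). init m i \<omega> = x i}
    | _ \<Rightarrow> {\<omega> \<in> space (sample m). init0 m \<omega> = x0})"
  unfolding rectangle_def
proof (intro conjI ballI)
  have "{\<omega> \<in> space (sample m). init m i \<omega> = x i} \<in> primitive_events m (Init i)" for i
    unfolding primitive_events.simps by (rule generated_eventsI[where A = "{x i}"]) auto
  moreover have "{\<omega> \<in> space (sample m). init0 m \<omega> = x0} \<in> primitive_events m Init0"
    unfolding primitive_events.simps by (rule generated_eventsI[where A = "{x0}"]) auto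
  moreover fix j :: "'n primitive"
  assume "j \<in> primitives_before 1"
  ultimately show "(case j of Init i \<Rightarrow> {\<omega> \<in> space (sample m). init m i \<omega> = x i}
      | _ \<Rightarrow> {\<omega> \<in> space (sample m). init0 m \<omega> = x0}) \<in> primitive_events m j"
    by (auto simp: primitives_before_def simp del: primitive_events.simps)
qed (auto simp: history_event_def primitives_before_def)

lemma history_event_Suc:
  assumes "1 \<le> t" "length h = t"
    and "last h = (x, x0)"
    and "a t (map (empirical \<circ> fst) h) (map snd h) x = (u, u0)"
  shows "history_event a (Suc t) (h @ [(x', x0')]) =
    history_event a t h \<inter> (\<Inter>i. noise_event t x x0 u x' i) \<inter> noise0_event t x x0 u0 x0'"
proof -
  have "history m a \<omega> (Suc t) = h @ [(x', x0')] \<longleftrightarrow> history m a \<omega> t = h \<and>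
      (\<forall>i. dyn m t (empirical x) x0 (x i) (u i) (noise m i t \<omega>) = x' i) \<and>
      dyn0 m t (empirical x) x0 u0 (noise0 m t \<omega>) = x0'" for \<omega>
  proof (cases "history m a \<omega> t = h")
    case True
    then show ?thesis
      using assms(1) by (simp add: Let_def assms(3,4) fun_eq_iff)
  next
    case False
    moreover have "history m a \<omega> t = butlast (history m a \<omega> (Suc t))"
      by (simp add: history_eq)
    ultimately show ?thesis by auto
  qed
  then show ?thesis
    unfolding history_event_def noise_event_def noise0_event_def by blast
qed

text \<open>
  One more transition constrains the noises at time \<open>t\<close> and keeps the constraints on the earlier
  primitive random variables.
\<close>

definition extend_rectangle where
  "extend_rectangle t x x0 u u0 x' x0' E j = (case j of
      Noise i s \<Rightarrow> if s = t then noise_event t x x0 u x' i else E j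
    | Noise0 s \<Rightarrow> if s = t then noise0_event t x x0 u0 x0' else E j
    | _ \<Rightarrow> E j)"

lemma extend_rectangle_simps:
  shows "extend_rectangle t x x0 u u0 x' x0' E (Noise i t) = noise_event t x x0 u x' i"
    and "extend_rectangle t x x0 u u0 x' x0' E (Noise0 t) = noise0_event t x x0 u0 x0'"
    and "j \<in> primitives_before t \<Longrightarrow> extend_rectangle t x x0 u u0 x' x0' E j = E j"
  by (auto simp: extend_rectangle_def primitives_before_def)

lemma rectangle_step:
  assumes t: "t \<in> {1..horizon m}" and h: "length h = t" "last h = (x, x0)"
    and act: "a t (map (empirical \<circ> fst) h) (map snd h) x = (u, u0)"
    and E: "rectangle a t h E"
  shows "rectangle a (Suc t) (h @ [(x', x0')]) (extend_rectangle t x x0 u u0 x' x0' E)"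
    (is "rectangle _ _ _ ?E")
  unfolding rectangle_def
proof (intro conjI ballI)
  have t1: "1 \<le> t" using t by simp
  show "?E j \<in> primitive_events m j" if "j \<in> primitives_before (Suc t)" for j
    using that noise_event_primitive(1)[OF t] noise0_event_primitive[OF t] E
    unfolding primitives_before_Suc[OF t1] rectangle_def
    by (auto simp: extend_rectangle_simps simp del: primitive_events.simps)
  have "(\<Inter>j\<in>primitives_before (Suc t). ?E j) = (\<Inter>j\<in>primitives_before t. E j) \<inter>
      (\<Inter>i. noise_event t x x0 u x' i) \<inter> noise0_event t x x0 u0 x0'"
    unfolding primitives_before_Suc[OF t1] INT_Un
    by (auto simp: extend_rectangle_simps)
  then show "history_event a (Suc t) (h @ [(x', x0')]) = (\<Inter>j\<in>primitives_before (Suc t). ?E j)"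
    using history_event_Suc[of t h x x0 a, OF t1 h act] E by (simp add: rectangle_def)
qed

lemma rectangle_exists:
  assumes "1 \<le> t" "t \<le> Suc (horizon m)" "length h = t"
  shows "\<exists>E. rectangle a t h E"
  using assms
proof (induction t arbitrary: h rule: nat_induct_at_least)
  case base
  then obtain x x0 where "h = [(x, x0)]"
    by (metis One_nat_def Suc_length_conv length_0_conv surj_pair)
  then show ?case
    using rectangle_init by blast
next
  case (Suc t)
  obtain h' x' x0' where h: "h = h' @ [(x', x0')]" "length h' = t"
    using Suc.prems by (cases h rule: rev_cases) auto
  obtain x x0 where l: "last h' = (x, x0)" by fastforce
  obtain u u0 where act: "a t (map (empirical \<circ> fst) h') (map snd h') x = (u, u0)" by fastforce
  obtain E where "rectangle a t h' E"
    using Suc.IH[of h'] Suc.prems h by auto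
  then show ?case
    unfolding h(1) using rectangle_step[where a = a, OF _ h(2) l act] Suc.hyps Suc.prems
    by (intro exI) auto
qed

lemma prob_history_init:
  "prob (history_event a 1 [(x, x0)]) = init_prob x x0"
proof -
  have "primitives_before 1 = insert Init0 (range (Init :: 'n \<Rightarrow> _))"
    by (auto simp: primitives_before_def)
  moreover have "inj (Init :: 'n \<Rightarrow> _)"
    by (simp add: inj_def)
  ultimately show ?thesis
    using prob_rectangle[OF rectangle_init[of a x x0]]
    by (simp add: init_prob_def prod.reindex image_iff mult.commute)
qed

text \<open>
  The history is a controlled Markov chain: independence of the rectangle's sides splits off the
  factors contributed by the noises at time \<open>t\<close>.
\<close>

lemma prob_history_Suc:
  assumes t: "t \<in> {1..horizon m}" and h: "length h = t" "last h = (x, x0)"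
    and act: "a t (map (empirical \<circ> fst) h) (map snd h) x = (u, u0)"
  shows "prob (history_event a (Suc t) (h @ [(x', x0')])) =
    prob (history_event a t h) * trans_prob t x x0 u u0 x' x0'"
proof -
  obtain E where E: "rectangle a t h E"
    using rectangle_exists[of t h a] t h by auto
  let ?E = "extend_rectangle t x x0 u u0 x' x0' E"
  have "prob (history_event a (Suc t) (h @ [(x', x0')])) =
      (\<Prod>j\<in>primitives_before (Suc t). prob (?E j))"
    by (rule prob_rectangle[OF rectangle_step]) (use t h act E in auto)
  also have "\<dots> = (\<Prod>j\<in>primitives_before t. prob (?E j)) *
      (\<Prod>j\<in>range (\<lambda>i. Noise i t) \<union> {Noise0 t}. prob (?E j))"
    unfolding primitives_before_Suc[OF t[unfolded atLeastAtMost_iff, THEN conjunct1]]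
    by (rule prod.union_disjoint[OF finite_primitives_before])
      (auto simp: primitives_before_def)
  also have "(\<Prod>j\<in>primitives_before t. prob (?E j)) = (\<Prod>j\<in>primitives_before t. prob (E j))"
    by (rule prod.cong) (simp_all add: extend_rectangle_simps)
  also have "\<dots> = prob (history_event a t h)"
    using prob_rectangle[OF E] t by simp
  also have "(\<Prod>j\<in>range (\<lambda>i. Noise i t) \<union> {Noise0 t}. prob (?E j)) =
      trans_prob t x x0 u u0 x' x0'"
    by (subst prod.union_disjoint) (auto simp: trans_prob_def prod.reindex inj_def extend_rectangle_simps)
  finally show ?thesis .
qed

lemma history_event_in_events:
  assumes "1 \<le> t" "t \<le> Suc (horizon m)"
  shows "history_event a t h \<in> events"
proof (cases "length h = t")
  case True
  obtain E where E: "rectangle a t h E"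
    using rectangle_exists[OF assms True] by blast
  have "primitive_events m j \<subseteq> events" if "j \<in> primitives_before t" for j
    by (rule bspec[OF conjunct1[OF primitive_indep[unfolded indep_sets_def]]],
        rule subsetD[OF primitive_index_subset[OF assms(2)] that])
  then have "E j \<in> events" if "j \<in> primitives_before t" for j
    using that E unfolding rectangle_def by blast
  then show ?thesis
    using E sets.finite_INT[of "primitives_before t" E]
    by (auto simp: rectangle_def primitives_before_nonempty)
next
  case False
  then have "history_event a t h = {}"
    by (auto simp: history_event_def)
  then show ?thesis by simp
qed

text \<open>
  There are only countably many histories, so measurability of the single-history events is enough.
\<close>

lemma history_measurable:
  assumes "1 \<le> t" "t \<le> Suc (horizon m)"
  shows "(\<lambda>\<omega>. history m a \<omega> t) \<in> measurable (sample m) (count_space UNIV)"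
  using history_event_in_events[OF assms, of a]
  by (auto simp: measurable_count_space_eq2_countable history_event_def vimage_def Int_def conj_commute)

lemma prob_history_sum:
  assumes "1 \<le> t" "t \<le> Suc (horizon m)"
  shows "prob {\<omega> \<in> space (sample m). history m a \<omega> t \<in> A} =
    (\<Sum>h | length h = t \<and> h \<in> A. prob (history_event a t h))"
proof -
  have fin: "finite {h :: (('n \<Rightarrow> 'x) \<times> 'x0) list. length h = t \<and> h \<in> A}"
    by (rule rev_finite_subset[OF finite_lists_of_length[of t]]) auto
  have "{\<omega> \<in> space (sample m). history m a \<omega> t \<in> A} =
      (\<Union>h\<in>{h. length h = t \<and> h \<in> A}. history_event a t h)"
    by (auto simp: history_event_def)
  then show ?thesis
    using history_event_in_events[OF assms, of a] fin
    by (simp only:) (subst finite_measure_finite_Union,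
        auto simp: disjoint_family_on_def history_event_def)
qed

section \<open>Exchangeability\<close>

text \<open>
  The minor subsystem \<open>i\<close> of the permuted system makes the transition of subsystem \<open>\<pi> i\<close> of the
  original one, but driven by its own noise; identical distribution of the noises makes up for
  the difference.
\<close>

lemma prob_noise_event_permute:
  assumes t: "t \<in> {1..horizon m}" and "bij \<pi>"
  shows "prob (noise_event t (x \<circ> \<pi>) x0 (u \<circ> \<pi>) (x' \<circ> \<pi>) i) =
    prob (noise_event t x x0 u x' (\<pi> i))"
proof -
  let ?A = "dyn m t (empirical x) x0 (x (\<pi> i)) (u (\<pi> i)) -` {x' (\<pi> i)} \<inter> space (noise_space m t)"
  have A: "?A \<in> sets (noise_space m t)"
    by (rule noise_event_primitive(3)[OF t])
  have "prob (noise_event t (x \<circ> \<pi>) x0 (u \<circ> \<pi>) (x' \<circ> \<pi>) i) =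
      measure (distr (sample m) (noise_space m t) (noise m i t)) ?A"
    using A noise_event_primitive(2)[OF t, of "x \<circ> \<pi>" x0 "u \<circ> \<pi>" "x' \<circ> \<pi>" i]
    by (simp add: measure_distr[OF noise_measurable[OF t]] empirical_permute[OF assms(2)])
  also have "\<dots> = measure (distr (sample m) (noise_space m t) (noise m (\<pi> i) t)) ?A"
    by (simp add: noise_ident[OF t, of i "\<pi> i"])
  also have "\<dots> = prob (noise_event t x x0 u x' (\<pi> i))"
    using A noise_event_primitive(2)[OF t, of x x0 u x' "\<pi> i"]
    by (simp add: measure_distr[OF noise_measurable[OF t]])
  finally show ?thesis .
qed

lemma trans_prob_permute:
  assumes "t \<in> {1..horizon m}" "bij \<pi>"
  shows "trans_prob t (x \<circ> \<pi>) x0 (u \<circ> \<pi>) u0 (x' \<circ> \<pi>) x0' = trans_prob t x x0 u u0 x' x0'"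
proof -
  have "noise0_event t (x \<circ> \<pi>) x0 u0 x0' = noise0_event t x x0 u0 x0'"
    by (simp add: noise0_event_def empirical_permute[OF assms(2)])
  then show ?thesis
    unfolding trans_prob_def prob_noise_event_permute[OF assms]
    by (simp add: prod.reindex_bij_betw[OF assms(2), of "\<lambda>i. prob (noise_event t x x0 u x' i)"])
qed

lemma init_prob_permute:
  assumes "bij \<pi>"
  shows "init_prob (x \<circ> \<pi>) x0 = init_prob x x0"
proof -
  have "prob {\<omega> \<in> space (sample m). init m i \<omega> = y} =
      measure (distr (sample m) (count_space UNIV) (init m i)) {y}" for i y
    by (subst measure_distr) (auto simp: init_measurable vimage_def Int_def conj_commute)
  then have "prob {\<omega> \<in> space (sample m). init m i \<omega> = y} =
      prob {\<omega> \<in> space (sample m). init m j \<omega> = y}" for i j y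
    using init_ident[of i j] by simp
  then have "prob {\<omega> \<in> space (sample m). init m i \<omega> = x (\<pi> i)} =
      prob {\<omega> \<in> space (sample m). init m (\<pi> i) \<omega> = x (\<pi> i)}" for i
    by blast
  then show ?thesis
    unfolding init_prob_def comp_def
    by (simp add: prod.reindex_bij_betw[OF assms,
          of "\<lambda>i. prob {\<omega> \<in> space (sample m). init m i \<omega> = x i}"])
qed

text \<open>
  The prescription is computed from the mean fields and major states, which a permutation does
  not change. Hence the permuted history is generated by the same prescriptions, and each factor
  of the product formula for its probability is invariant. This is where the restriction to
  identical control laws for the minor subsystems enters.
\<close>

lemma history_exchangeable:
  assumes \<pi>: "bij \<pi>" and "1 \<le> t" "t \<le> Suc (horizon m)" "length h = t"
  shows "prob (history_event (coordination_rule \<psi>) t (permute_history \<pi> h)) =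
    prob (history_event (coordination_rule \<psi>) t h)"
  using assms(2-)
proof (induction t arbitrary: h rule: nat_induct_at_least)
  case base
  then obtain x x0 where "h = [(x, x0)]"
    by (metis One_nat_def Suc_length_conv length_0_conv surj_pair)
  then show ?case
    using prob_history_init init_prob_permute[OF \<pi>] by (simp add: permute_history_def)
next
  case (Suc t)
  obtain h' x' x0' where h: "h = h' @ [(x', x0')]" "length h' = t"
    using Suc.prems by (cases h rule: rev_cases) auto
  obtain x x0 where l: "last h' = (x, x0)" by fastforce
  obtain \<gamma> u0 where act: "\<psi> t (map (empirical \<circ> fst) h') (map snd h') = (\<gamma>, u0)" by fastforce
  have t: "t \<in> {1..horizon m}" and t': "t \<le> Suc (horizon m)" using Suc by auto
  have "h' \<noteq> []" using h t by auto
  then have l': "last (permute_history \<pi> h') = (x \<circ> \<pi>, x0)"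
    using l by (simp add: permute_history_def last_map)
  have step: "prob (history_event (coordination_rule \<psi>) (Suc t) (h' @ [(x', x0')])) =
      prob (history_event (coordination_rule \<psi>) t h') * trans_prob t x x0 (\<gamma> \<circ> x) u0 x' x0'"
    by (rule prob_history_Suc[OF t h(2) l]) (unfold coordination_rule_def act, simp add: comp_def)
  have step': "prob (history_event (coordination_rule \<psi>) (Suc t)
        (permute_history \<pi> h' @ [(x' \<circ> \<pi>, x0')])) =
      prob (history_event (coordination_rule \<psi>) t (permute_history \<pi> h')) *
        trans_prob t (x \<circ> \<pi>) x0 ((\<gamma> \<circ> x) \<circ> \<pi>) u0 (x' \<circ> \<pi>) x0'"
    by (rule prob_history_Suc[OF t _ l'])
      (unfold coordination_rule_def map_empirical_permute_history[OF \<pi>] map_snd_permute_history act,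
        simp_all add: h comp_def)
  have "permute_history \<pi> h = permute_history \<pi> h' @ [(x' \<circ> \<pi>, x0')]"
    by (simp add: h permute_history_def)
  then show ?case
    using step step' Suc.IH[OF t' h(2)] trans_prob_permute[OF t \<pi>] h by simp
qed

section \<open>The conditional law of one step\<close>

text \<open>The histories on which \<^const>\<open>info_event\<close> occurs.\<close>

definition info_histories where
  "info_histories \<psi> t z x0 \<gamma> u0 = {h. length h = t \<and> empirical (fst (last h)) = z \<and>
    snd (last h) = x0 \<and> \<psi> t (map (empirical \<circ> fst) h) (map snd h) = (\<gamma>, u0)}"

lemma info_event_eq_history:
  "info_event m \<psi> t z x0 \<gamma> u0 = {\<omega> \<in> space (sample m).
    history m (coordination_rule \<psi>) \<omega> t \<in> info_histories \<psi> t z x0 \<gamma> u0}"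
  by (auto simp: info_event_def info_histories_def \<Gamma>_def U0_def coordination_rule_def Z_def
      X_def[symmetric] X0_def[symmetric] Zs_X0s_eq_history[symmetric] case_prod_unfold prod_eq_iff
      Let_def)

lemma info_event_in_events:
  assumes "1 \<le> t" "t \<le> Suc (horizon m)"
  shows "info_event m \<psi> t z x0 \<gamma> u0 \<in> events"
  using measurable_sets[OF history_measurable[OF assms, of "coordination_rule \<psi>"],
      of "info_histories \<psi> t z x0 \<gamma> u0"]
  by (simp add: info_event_eq_history vimage_def Int_def conj_commute)

lemma prob_info_state:
  assumes "1 \<le> t" "t \<le> Suc (horizon m)"
  shows "prob {\<omega> \<in> info_event m \<psi> t z x0 \<gamma> u0. X m (coordination_rule \<psi>) t \<omega> = x} =
    (\<Sum>h | h \<in> info_histories \<psi> t z x0 \<gamma> u0 \<and> fst (last h) = x.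
      prob (history_event (coordination_rule \<psi>) t h))"
proof -
  have "{\<omega> \<in> info_event m \<psi> t z x0 \<gamma> u0. X m (coordination_rule \<psi>) t \<omega> = x} =
      {\<omega> \<in> space (sample m). history m (coordination_rule \<psi>) \<omega> t \<in>
        {h \<in> info_histories \<psi> t z x0 \<gamma> u0. fst (last h) = x}}"
    by (auto simp: info_event_eq_history X_def)
  moreover have "{h. length h = t \<and> h \<in> {h \<in> info_histories \<psi> t z x0 \<gamma> u0. fst (last h) = x}} =
      {h. h \<in> info_histories \<psi> t z x0 \<gamma> u0 \<and> fst (last h) = x}"
    by (auto simp: info_histories_def)
  ultimately show ?thesis
    by (simp only: prob_history_sum[OF assms])
qed

text \<open>
  Permuting histories maps those in the event that end in \<open>x\<close> bijectively onto those in the event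
  that end in \<open>x \<circ> \<pi>\<close>, and preserves their probabilities.
\<close>

lemma prob_info_state_permute:
  assumes t: "1 \<le> t" "t \<le> Suc (horizon m)" and \<pi>: "bij \<pi>"
  shows "prob {\<omega> \<in> info_event m \<psi> t z x0 \<gamma> u0. X m (coordination_rule \<psi>) t \<omega> = x \<circ> \<pi>} =
    prob {\<omega> \<in> info_event m \<psi> t z x0 \<gamma> u0. X m (coordination_rule \<psi>) t \<omega> = x}"
proof -
  let ?H = "\<lambda>x. {h. h \<in> info_histories \<psi> t z x0 \<gamma> u0 \<and> fst (last h) = x}"
  have sub: "permute_history \<pi> h \<in> ?H (x \<circ> \<pi>)" if "h \<in> ?H x" "bij \<pi>" for h x \<pi>
  proof -
    have "h \<noteq> []" using that t by (auto simp: info_histories_def)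
    then have "last (permute_history \<pi> h) = apfst (\<lambda>x. x \<circ> \<pi>) (last h)"
      by (simp add: permute_history_def last_map)
    then show ?thesis
      using that(1) unfolding info_histories_def mem_Collect_eq
        map_empirical_permute_history[OF that(2)]
      by (auto simp: empirical_permute[OF that(2)])
  qed
  have "x = (x \<circ> \<pi>) \<circ> inv \<pi>"
    using \<pi> by (simp add: o_assoc[symmetric] bij_is_surj surj_iff[THEN iffD1])
  then have unpermuted: "permute_history (inv \<pi>) h \<in> ?H x" if "h \<in> ?H (x \<circ> \<pi>)" for h
    using sub[OF that bij_imp_bij_inv[OF \<pi>]] by simp
  have img: "?H (x \<circ> \<pi>) = permute_history \<pi> ` ?H x"
  proof (intro equalityI subsetI)
    fix h assume "h \<in> ?H (x \<circ> \<pi>)"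
    then show "h \<in> permute_history \<pi> ` ?H x"
      by (intro image_eqI[of h _ "permute_history (inv \<pi>) h"] unpermuted)
        (simp add: permute_history_inverse[OF \<pi>])
  qed (use sub[OF _ \<pi>] in blast)
  have "(\<Sum>h\<in>?H (x \<circ> \<pi>). prob (history_event (coordination_rule \<psi>) t h)) =
      (\<Sum>h\<in>?H x. prob (history_event (coordination_rule \<psi>) t (permute_history \<pi> h)))"
    unfolding img using inj_permute_history[OF \<pi>]
    by (subst sum.reindex) (auto intro: inj_on_subset)
  also have "\<dots> = (\<Sum>h\<in>?H x. prob (history_event (coordination_rule \<psi>) t h))"
    by (intro sum.cong refl history_exchangeable[OF \<pi> t]) (auto simp: info_histories_def)
  finally show ?thesis
    by (simp only: prob_info_state[OF t])
qed

text \<open>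
  Any two joint states with mean field \<open>z\<close> are permutations of each other, so they share the
  probability of the event equally.
\<close>

lemma prob_info_state_uniform:
  assumes t: "1 \<le> t" "t \<le> Suc (horizon m)" and x: "empirical x = z"
  shows "prob {\<omega> \<in> info_event m \<psi> t z x0 \<gamma> u0. X m (coordination_rule \<psi>) t \<omega> = x} =
    prob (info_event m \<psi> t z x0 \<gamma> u0) / card {y :: 'n \<Rightarrow> 'x. empirical y = z}"
proof -
  let ?A = "\<lambda>y. {\<omega> \<in> info_event m \<psi> t z x0 \<gamma> u0. X m (coordination_rule \<psi>) t \<omega> = y}"
  let ?C = "{y :: 'n \<Rightarrow> 'x. empirical y = z}"
  have meas: "?A y \<in> events" for y
    using measurable_sets[OF history_measurable[OF t, of "coordination_rule \<psi>"],
        of "{h \<in> info_histories \<psi> t z x0 \<gamma> u0. fst (last h) = y}"]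
    by (simp add: info_event_eq_history X_def vimage_def Int_def conj_ac)
  have "info_event m \<psi> t z x0 \<gamma> u0 = (\<Union>y\<in>?C. ?A y)"
    by (auto simp: info_event_def Z_def)
  then have "prob (info_event m \<psi> t z x0 \<gamma> u0) = prob (\<Union>y\<in>?C. ?A y)"
    by (rule arg_cong)
  also have "\<dots> = (\<Sum>y\<in>?C. prob (?A y))"
    using meas by (intro finite_measure_finite_Union) (auto simp: disjoint_family_on_def)
  also have "\<dots> = (\<Sum>y\<in>?C. prob (?A x))"
  proof (rule sum.cong)
    fix y assume "y \<in> ?C"
    then obtain \<pi> where "bij \<pi>" "y = x \<circ> \<pi>"
      using empirical_eq_imp_permute[of x y] x by auto
    then show "prob (?A y) = prob (?A x)"
      using prob_info_state_permute[OF t] by blast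
  qed simp
  finally have "prob (info_event m \<psi> t z x0 \<gamma> u0) = card ?C * prob (?A x)"
    by simp
  moreover have "card ?C \<noteq> 0"
    using x by auto
  ultimately show ?thesis by simp
qed

text \<open>
  The conditional law of \<open>(X\<^sub>t, X\<^sub>t\<^sub>+\<^sub>1, X\<^sup>0\<^sub>t\<^sub>+\<^sub>1)\<close> given \<open>(Z\<^sub>t, X\<^sup>0\<^sub>t, \<Gamma>\<^sub>t, U\<^sup>0\<^sub>t)\<close>: draw the joint
  state uniformly among those with mean field \<open>z\<close>, then make one transition. No strategy occurs
  in it.
\<close>

definition step_law where
  "step_law t z x0 \<gamma> u0 x x' x0' = (if empirical x = z
    then trans_prob t x x0 (\<gamma> \<circ> x) u0 x' x0' / card {y :: 'n \<Rightarrow> 'x. empirical y = z} else 0)"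

lemma prob_info_step:
  assumes t: "t \<in> {1..horizon m}"
  shows "prob {\<omega> \<in> info_event m \<psi> t z x0 \<gamma> u0. X m (coordination_rule \<psi>) t \<omega> = x \<and>
      X m (coordination_rule \<psi>) (Suc t) \<omega> = x' \<and> X0 m (coordination_rule \<psi>) (Suc t) \<omega> = x0'} =
    prob (info_event m \<psi> t z x0 \<gamma> u0) * step_law t z x0 \<gamma> u0 x x' x0'"
    (is "prob ?A = _")
proof (cases "empirical x = z")
  case False
  then have empty: "?A = {}"
    by (auto simp: info_event_def Z_def)
  show ?thesis
    unfolding empty using False by (simp add: step_law_def)
next
  case True
  have t1: "1 \<le> t" "t \<le> Suc (horizon m)" and t2: "1 \<le> Suc t" "Suc t \<le> Suc (horizon m)"
    using t by auto
  let ?a = "coordination_rule \<psi>"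
  let ?H = "{h. h \<in> info_histories \<psi> t z x0 \<gamma> u0 \<and> fst (last h) = x}"
  let ?f = "\<lambda>h. h @ [(x', x0')]"
  have split: "history m ?a \<omega> (Suc t) =
      history m ?a \<omega> t @ [(X m ?a (Suc t) \<omega>, X0 m ?a (Suc t) \<omega>)]" for \<omega>
    by (simp add: history_eq)
  have "?A = {\<omega> \<in> space (sample m). history m ?a \<omega> (Suc t) \<in> ?f ` ?H}"
    unfolding info_event_eq_history split X_def[of m ?a t] by auto
  moreover have "{h. length h = Suc t \<and> h \<in> ?f ` ?H} = ?f ` ?H"
    by (auto simp: info_histories_def)
  ultimately have "prob ?A = (\<Sum>h\<in>?f ` ?H. prob (history_event ?a (Suc t) h))"
    by (simp only: prob_history_sum[OF t2])
  also have "\<dots> = (\<Sum>h\<in>?H. prob (history_event ?a (Suc t) (h @ [(x', x0')])))"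
    by (subst sum.reindex) (auto simp: inj_on_def)
  also have "\<dots> = (\<Sum>h\<in>?H. prob (history_event ?a t h) * trans_prob t x x0 (\<gamma> \<circ> x) u0 x' x0')"
  proof (rule sum.cong)
    fix h assume h: "h \<in> ?H"
    then have act: "\<psi> t (map (empirical \<circ> fst) h) (map snd h) = (\<gamma>, u0)"
      and l: "length h = t" "last h = (x, x0)"
      by (auto simp: info_histories_def prod_eq_iff)
    show "prob (history_event ?a (Suc t) (h @ [(x', x0')])) =
        prob (history_event ?a t h) * trans_prob t x x0 (\<gamma> \<circ> x) u0 x' x0'"
      by (rule prob_history_Suc[OF t l]) (unfold coordination_rule_def act, simp add: comp_def)
  qed simp
  also have "\<dots> = prob {\<omega> \<in> info_event m \<psi> t z x0 \<gamma> u0. X m ?a t \<omega> = x} *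
      trans_prob t x x0 (\<gamma> \<circ> x) u0 x' x0'"
    by (simp only: prob_info_state[OF t1] sum_distrib_right)
  finally show ?thesis
    using True by (simp add: prob_info_state_uniform[OF t1 True] step_law_def)
qed

definition step_mean where
  "step_mean t z x0 \<gamma> u0 F =
    (\<Sum>(x, x', x0')\<in>UNIV. step_law t z x0 \<gamma> u0 x x' x0' * F x x' x0')"

text \<open>A function of the history takes finitely many values and is therefore bounded.\<close>

lemma integrable_history:
  fixes f :: "(('n \<Rightarrow> 'x) \<times> 'x0) list \<Rightarrow> real"
  assumes "1 \<le> t" "t \<le> Suc (horizon m)" and eq: "\<And>\<omega>. g \<omega> = f (history m a \<omega> t)"
  shows "integrable (sample m) g"
proof -
  have "\<bar>f (history m a \<omega> t)\<bar> \<le> (\<Sum>h | length h = t. \<bar>f h\<bar>)" for \<omega>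
    by (rule member_le_sum[of "history m a \<omega> t" _ "\<lambda>h. \<bar>f h\<bar>"]) (auto simp: finite_lists_of_length)
  moreover have "(\<lambda>\<omega>. f (history m a \<omega> t)) \<in> borel_measurable (sample m)"
    by (rule measurable_compose[OF history_measurable[OF assms(1,2)]]) simp
  ultimately show ?thesis
    unfolding eq[abs_def] by (intro integrable_const_bound) auto
qed

text \<open>
  The product form, with the event's probability as a factor instead of a denominator, covers
  strategies that give the event probability 0 as well.
\<close>

lemma expectation_info_step:
  assumes t: "t \<in> {1..horizon m}"
    and G: "\<And>\<omega>. \<omega> \<in> info_event m \<psi> t z x0 \<gamma> u0 \<Longrightarrow> G \<omega> = F (X m (coordination_rule \<psi>) t \<omega>)
      (X m (coordination_rule \<psi>) (Suc t) \<omega>) (X0 m (coordination_rule \<psi>) (Suc t) \<omega>)"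
  shows "expectation (\<lambda>\<omega>. indicator (info_event m \<psi> t z x0 \<gamma> u0) \<omega> * G \<omega>) =
    prob (info_event m \<psi> t z x0 \<gamma> u0) * step_mean t z x0 \<gamma> u0 F"
proof -
  let ?a = "coordination_rule \<psi>"
  let ?A = "\<lambda>(x, x', x0'). {\<omega> \<in> info_event m \<psi> t z x0 \<gamma> u0. X m ?a t \<omega> = x \<and>
      X m ?a (Suc t) \<omega> = x' \<and> X0 m ?a (Suc t) \<omega> = x0'}"
  have meas: "?A q \<in> events" for q
  proof -
    obtain x x' x0' where q: "q = (x, x', x0')" by (cases q)
    have "?A q = {\<omega> \<in> space (sample m). history m ?a \<omega> (Suc t) \<in>
        (\<lambda>h. h @ [(x', x0')]) ` {h. h \<in> info_histories \<psi> t z x0 \<gamma> u0 \<and> fst (last h) = x}}"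
      unfolding info_event_eq_history q X_def[of m ?a t]
      by (auto simp: history_eq)
    also have "\<dots> \<in> events"
      using measurable_sets[OF history_measurable[of "Suc t" ?a],
          of "(\<lambda>h. h @ [(x', x0')]) ` {h. h \<in> info_histories \<psi> t z x0 \<gamma> u0 \<and> fst (last h) = x}"] t
      by (simp add: vimage_def Int_def conj_commute)
    finally show ?thesis .
  qed
  have "indicator (info_event m \<psi> t z x0 \<gamma> u0) \<omega> * G \<omega> =
      (\<Sum>q\<in>UNIV. indicator (?A q) \<omega> * (case q of (x, x', x0') \<Rightarrow> F x x' x0'))" for \<omega>
  proof (cases "\<omega> \<in> info_event m \<psi> t z x0 \<gamma> u0")
    case True
    let ?q = "(X m ?a t \<omega>, X m ?a (Suc t) \<omega>, X0 m ?a (Suc t) \<omega>)"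
    have "indicator (?A q) \<omega> * (case q of (x, x', x0') \<Rightarrow> F x x' x0') =
        (if q = ?q then case q of (x, x', x0') \<Rightarrow> F x x' x0' else 0)" for q
      using True by (auto split: prod.splits simp: indicator_def)
    then show ?thesis
      using True G[OF True] by simp
  next
    case False
    then have "indicator (?A q) \<omega> * c = (0 :: real)" for q c
      by (cases q) simp
    then show ?thesis
      using False by (simp only: sum.neutral_const) simp
  qed
  then have "expectation (\<lambda>\<omega>. indicator (info_event m \<psi> t z x0 \<gamma> u0) \<omega> * G \<omega>) =
      (\<Sum>q\<in>UNIV. expectation (\<lambda>\<omega>. indicator (?A q) \<omega> * (case q of (x, x', x0') \<Rightarrow> F x x' x0')))"
    using meas by (simp only:) (intro Bochner_Integration.integral_sum integrable_mult_left
        integrable_real_indicator, auto simp: less_top[symmetric])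
  also have "\<dots> = (\<Sum>q\<in>UNIV. prob (?A q) * (case q of (x, x', x0') \<Rightarrow> F x x' x0'))"
    using meas by (intro sum.cong refl) (simp add: less_top[symmetric])
  also have "\<dots> = (\<Sum>q\<in>UNIV. prob (info_event m \<psi> t z x0 \<gamma> u0) * (case q of (x, x', x0') \<Rightarrow>
      step_law t z x0 \<gamma> u0 x x' x0' * F x x' x0'))"
    by (intro sum.cong refl) (auto simp: prob_info_step[OF t] split: prod.splits)
  finally show ?thesis
    by (simp add: step_mean_def sum_distrib_left)
qed

lemma integral_uniform_measure:
  fixes f :: "'w \<Rightarrow> real"
  assumes A: "A \<in> events" "prob A > 0" and f: "f \<in> borel_measurable (sample m)"
  shows "integral\<^sup>L (uniform_measure (sample m) A) f = expectation (\<lambda>\<omega>. indicator A \<omega> * f \<omega>) / prob A"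
proof -
  have "uniform_measure (sample m) A = density (sample m) (\<lambda>\<omega>. ennreal (indicator A \<omega> / prob A))"
    unfolding uniform_measure_def using A
    by (intro arg_cong[where f = "density _"] ext)
      (auto simp: emeasure_eq_measure divide_ennreal[symmetric] split: split_indicator)
  then have "integral\<^sup>L (uniform_measure (sample m) A) f =
      expectation (\<lambda>\<omega>. indicator A \<omega> / prob A * f \<omega>)"
    using A f by (simp add: integral_density)
  also have "\<dots> = expectation (\<lambda>\<omega>. (indicator A \<omega> * f \<omega>) / prob A)"
    by simp
  finally show ?thesis
    by (simp only: integral_divide_zero)
qed

lemma stage_cost_on_info_event:
  assumes "\<omega> \<in> info_event m \<psi> t z x0 \<gamma> u0"
  shows "stage_cost m (coordination_rule \<psi>) t \<omega> =
    cost m t (X m (coordination_rule \<psi>) t \<omega>) x0 (\<gamma> \<circ> X m (coordination_rule \<psi>) t \<omega>) u0"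
  using assms by (auto simp: stage_cost_def info_event_def U_def U0_def \<Gamma>_def
      coordination_rule_def comp_def split: prod.splits)

lemma integrable_stage_cost:
  assumes "t \<in> {1..horizon m}"
  shows "integrable (sample m) (stage_cost m (coordination_rule \<psi>) t)"
  by (rule integrable_history[where t = t and a = "coordination_rule \<psi>" and
        f = "\<lambda>h. case coordination_rule \<psi> t (map (empirical \<circ> fst) h) (map snd h) (fst (last h)) of
          (u, u0) \<Rightarrow> cost m t (fst (last h)) (snd (last h)) u u0"])
    (use assms in \<open>auto simp: stage_cost_def U_def U0_def X_def X0_def Zs_X0s_eq_history
      split: prod.splits\<close>)

lemma integrable_state:
  assumes "1 \<le> t" "t \<le> Suc (horizon m)"
  shows "integrable (sample m) (\<lambda>\<omega>. v (Z m a t \<omega>) (X0 m a t \<omega>) :: real)"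
  by (rule integrable_history[where t = t and a = a and
        f = "\<lambda>h. v (empirical (fst (last h))) (snd (last h))"])
    (use assms in \<open>auto simp: Z_def X_def X0_def\<close>)

lemma state_measurable:
  assumes "1 \<le> t" "t \<le> Suc (horizon m)"
  shows "(\<lambda>\<omega>. (Z m a t \<omega>, X0 m a t \<omega>)) \<in> measurable (sample m) (count_space UNIV)"
  using measurable_compose[OF history_measurable[OF assms, of a],
      of "\<lambda>h. (empirical (fst (last h)), snd (last h))" "count_space UNIV"]
  by (simp add: Z_def X_def X0_def)

lemma conditional_expectation_of_cost:
  assumes t: "t \<in> {1..horizon m}" and \<psi>: "\<psi> \<in> realizing_strategies m t z x0 \<gamma> u0"
  shows "integral\<^sup>L (uniform_measure (sample m) (info_event m \<psi> t z x0 \<gamma> u0))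
      (stage_cost m (coordination_rule \<psi>) t) =
    step_mean t z x0 \<gamma> u0 (\<lambda>x _ _. cost m t x x0 (\<gamma> \<circ> x) u0)"
  using \<psi> t
  by (subst integral_uniform_measure)
    (auto simp: realizing_strategies_def info_event_in_events stage_cost_on_info_event
      intro!: borel_measurable_integrable integrable_stage_cost
      simp: expectation_info_step[where F = "\<lambda>x _ _. cost m t x x0 (\<gamma> \<circ> x) u0"])

text \<open>
  The number \<open>l t z x0 \<gamma> u0\<close> comes from some realizing strategy, perhaps not \<open>\<psi>\<close>. The two
  conditional expectations agree because both equal the same mean under \<^const>\<open>step_law\<close>.
\<close>

lemma expectation_info_cost:
  assumes l: "conditional_cost m l" and t: "t \<in> {1..horizon m}"
  shows "expectation (\<lambda>\<omega>. indicator (info_event m \<psi> t z x0 \<gamma> u0) \<omega> *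
      stage_cost m (coordination_rule \<psi>) t \<omega>) =
    prob (info_event m \<psi> t z x0 \<gamma> u0) * l t z x0 \<gamma> u0"
proof (cases "\<psi> \<in> realizing_strategies m t z x0 \<gamma> u0")
  case True
  then have "l t z x0 \<gamma> u0 = step_mean t z x0 \<gamma> u0 (\<lambda>x _ _. cost m t x x0 (\<gamma> \<circ> x) u0)"
    using l t conditional_expectation_of_cost[OF t, of _ z x0 \<gamma> u0]
    unfolding conditional_cost_def by (metis (no_types, lifting) empty_iff)
  then show ?thesis
    using expectation_info_step[OF t, of \<psi> z x0 \<gamma> u0 "stage_cost m (coordination_rule \<psi>) t"
        "\<lambda>x _ _. cost m t x x0 (\<gamma> \<circ> x) u0"] stage_cost_on_info_event
    by simp
next
  case False
  then have "prob (info_event m \<psi> t z x0 \<gamma> u0) = 0"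
    by (simp add: realizing_strategies_def not_less measure_le_0_iff)
  then show ?thesis
    using expectation_info_step[OF t, of \<psi> z x0 \<gamma> u0 "stage_cost m (coordination_rule \<psi>) t"
        "\<lambda>x _ _. cost m t x x0 (\<gamma> \<circ> x) u0"] stage_cost_on_info_event
    by simp
qed

text \<open>The same exchange of strategies for the conditional transition law.\<close>

lemma expectation_info_next:
  assumes K: "conditional_law m K" and t: "t \<in> {1..horizon m}"
  shows "expectation (\<lambda>\<omega>. indicator (info_event m \<psi> t z x0 \<gamma> u0) \<omega> *
      v (Z m (coordination_rule \<psi>) (Suc t) \<omega>) (X0 m (coordination_rule \<psi>) (Suc t) \<omega>)) =
    prob (info_event m \<psi> t z x0 \<gamma> u0) *
      measure_pmf.expectation (K t z x0 \<gamma> u0) (\<lambda>(z', x0'). v z' x0')"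
proof -
  let ?F = "\<lambda>_ x' x0'. v (empirical x') x0'"
  have step: "expectation (\<lambda>\<omega>. indicator (info_event m \<psi> t z x0 \<gamma> u0) \<omega> *
      v (Z m (coordination_rule \<psi>) (Suc t) \<omega>) (X0 m (coordination_rule \<psi>) (Suc t) \<omega>)) =
      prob (info_event m \<psi> t z x0 \<gamma> u0) * step_mean t z x0 \<gamma> u0 ?F" for \<psi>
    by (rule expectation_info_step[OF t]) (simp add: Z_def)
  show ?thesis
  proof (cases "\<psi> \<in> realizing_strategies m t z x0 \<gamma> u0")
    case False
    then have "prob (info_event m \<psi> t z x0 \<gamma> u0) = 0"
      by (simp add: realizing_strategies_def not_less measure_le_0_iff)
    then show ?thesis
      using step by simp
  next
    case True
    then have "realizing_strategies m t z x0 \<gamma> u0 \<noteq> {}" by blast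
    then obtain \<psi>' where \<psi>': "\<psi>' \<in> realizing_strategies m t z x0 \<gamma> u0"
      and eq: "measure_pmf (K t z x0 \<gamma> u0) =
        distr (uniform_measure (sample m) (info_event m \<psi>' t z x0 \<gamma> u0)) (count_space UNIV)
        (\<lambda>\<omega>. (Z m (coordination_rule \<psi>') (Suc t) \<omega>, X0 m (coordination_rule \<psi>') (Suc t) \<omega>))"
      using K[unfolded conditional_law_def, THEN bspec, OF t, THEN spec[of _ z], THEN spec[of _ x0],
          THEN spec[of _ \<gamma>], THEN spec[of _ u0]]
      by (simp only: if_True not_False_eq_True simp_thms) blast
    have pos: "prob (info_event m \<psi>' t z x0 \<gamma> u0) > 0"
      using \<psi>' by (simp add: realizing_strategies_def)
    have "measure_pmf.expectation (K t z x0 \<gamma> u0) (\<lambda>(z', x0'). v z' x0') =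
        integral\<^sup>L (uniform_measure (sample m) (info_event m \<psi>' t z x0 \<gamma> u0)) (\<lambda>\<omega>.
          v (Z m (coordination_rule \<psi>') (Suc t) \<omega>) (X0 m (coordination_rule \<psi>') (Suc t) \<omega>))"
      unfolding eq using state_measurable[of "Suc t" "coordination_rule \<psi>'"] t
      by (subst integral_distr) (auto simp: measurable_def uniform_measure_def)
    also have "\<dots> = step_mean t z x0 \<gamma> u0 ?F"
      using t pos integrable_state[of "Suc t" v "coordination_rule \<psi>'"] step[of \<psi>']
      by (subst integral_uniform_measure)
        (auto intro: info_event_in_events borel_measurable_integrable)
    finally show ?thesis
      using step by simp
  qed
qed

section \<open>The dynamic program\<close>

text \<open>
  The events \<^const>\<open>info_event\<close> partition the sample space. Mean fields range over the finite
  image of \<^const>\<open>empirical\<close>, since the type of all distributions is infinite in general.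
\<close>

lemma expectation_info_partition:
  fixes f :: "'w \<Rightarrow> real"
  assumes t: "1 \<le> t" "t \<le> Suc (horizon m)" and f: "integrable (sample m) f"
  shows "expectation f = (\<Sum>(z, x0, \<gamma>, u0)\<in>range (empirical :: ('n \<Rightarrow> 'x) \<Rightarrow> _) \<times> UNIV.
    expectation (\<lambda>\<omega>. indicator (info_event m \<psi> t z x0 \<gamma> u0) \<omega> * f \<omega>))"
proof -
  let ?a = "coordination_rule \<psi>"
  let ?Q = "range (empirical :: ('n \<Rightarrow> 'x) \<Rightarrow> _) \<times> (UNIV :: ('x0 \<times> ('x \<Rightarrow> 'u) \<times> 'u0) set)"
  let ?I = "\<lambda>(z, x0, \<gamma>, u0). info_event m \<psi> t z x0 \<gamma> u0"
  have "f \<omega> = (\<Sum>q\<in>?Q. indicator (?I q) \<omega> * f \<omega>)" if "\<omega> \<in> space (sample m)" for \<omega>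
  proof -
    let ?q = "(Z m ?a t \<omega>, X0 m ?a t \<omega>, \<Gamma> m \<psi> t \<omega>, U0 m ?a t \<omega>)"
    have "indicator (?I q) \<omega> * f \<omega> = (if q = ?q then f \<omega> else 0)" for q
      using that by (auto simp: info_event_def indicator_def split: prod.splits)
    moreover have "?q \<in> ?Q"
      by (simp add: Z_def)
    ultimately show ?thesis
      by simp
  qed
  then have "expectation f = expectation (\<lambda>\<omega>. \<Sum>q\<in>?Q. indicator (?I q) \<omega> * f \<omega>)"
    by (rule Bochner_Integration.integral_cong[OF refl])
  also have "\<dots> = (\<Sum>q\<in>?Q. expectation (\<lambda>\<omega>. indicator (?I q) \<omega> * f \<omega>))"
  proof (rule Bochner_Integration.integral_sum)
    show "integrable (sample m) (\<lambda>\<omega>. indicator (?I q) \<omega> * f \<omega>)" for q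
      using integrable_mult_indicator[OF _ f, of "?I q"] info_event_in_events[OF t]
      by (cases q) simp
  qed
  finally show ?thesis
    by (simp add: case_prod_unfold)
qed

text \<open>The Bellman right-hand side, evaluated along the trajectory generated by \<open>\<psi>\<close>.\<close>

definition bellman_at where
  "bellman_at l K v \<psi> t \<omega> = bellman_rhs l K v t (Z m (coordination_rule \<psi>) t \<omega>)
    (X0 m (coordination_rule \<psi>) t \<omega>) (\<Gamma> m \<psi> t \<omega>, U0 m (coordination_rule \<psi>) t \<omega>)"

lemma integrable_bellman_at:
  assumes "t \<in> {1..horizon m}"
  shows "integrable (sample m) (bellman_at l K v \<psi> t)"
  by (rule integrable_history[where t = t and a = "coordination_rule \<psi>" and
        f = "\<lambda>h. bellman_rhs l K v t (empirical (fst (last h))) (snd (last h))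
          (\<psi> t (map (empirical \<circ> fst) h) (map snd h))"])
    (use assms in \<open>auto simp: bellman_at_def U0_def \<Gamma>_def Z_def X_def X0_def Zs_X0s_eq_history
      coordination_rule_def split: prod.splits\<close>)

text \<open>
  On each event of the partition the right-hand side is a constant, and its two summands are the
  conditional expectations of the stage cost and of the continuation \<open>v\<close>. Summing over the
  partition is the tower property.
\<close>

lemma bellman_step:
  assumes l: "conditional_cost m l" and K: "conditional_law m K" and t: "t \<in> {1..horizon m}"
  shows "expectation (bellman_at l K v \<psi> t) =
    expectation (stage_cost m (coordination_rule \<psi>) t) +
    expectation (\<lambda>\<omega>. v (Z m (coordination_rule \<psi>) (Suc t) \<omega>) (X0 m (coordination_rule \<psi>) (Suc t) \<omega>))"
proof -
  have t1: "1 \<le> t" "t \<le> Suc (horizon m)" using t by auto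
  have "expectation (\<lambda>\<omega>. indicator (info_event m \<psi> t z x0 \<gamma> u0) \<omega> * bellman_at l K v \<psi> t \<omega>) =
      prob (info_event m \<psi> t z x0 \<gamma> u0) * bellman_rhs l K v t z x0 (\<gamma>, u0)" for z x0 \<gamma> u0
  proof -
    have "indicator (info_event m \<psi> t z x0 \<gamma> u0) \<omega> * bellman_at l K v \<psi> t \<omega> =
        indicator (info_event m \<psi> t z x0 \<gamma> u0) \<omega> * bellman_rhs l K v t z x0 (\<gamma>, u0)" for \<omega>
      by (auto simp: bellman_at_def info_event_def indicator_def)
    then have "expectation (\<lambda>\<omega>. indicator (info_event m \<psi> t z x0 \<gamma> u0) \<omega> * bellman_at l K v \<psi> t \<omega>) =
        expectation (\<lambda>\<omega>. indicator (info_event m \<psi> t z x0 \<gamma> u0) \<omega> * bellman_rhs l K v t z x0 (\<gamma>, u0))"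
      by (simp only:)
    then show ?thesis
      using info_event_in_events[OF t1] by (simp add: less_top[symmetric])
  qed
  also have "prob (info_event m \<psi> t z x0 \<gamma> u0) * bellman_rhs l K v t z x0 (\<gamma>, u0) =
      expectation (\<lambda>\<omega>. indicator (info_event m \<psi> t z x0 \<gamma> u0) \<omega> *
        stage_cost m (coordination_rule \<psi>) t \<omega>) +
      expectation (\<lambda>\<omega>. indicator (info_event m \<psi> t z x0 \<gamma> u0) \<omega> *
        v (Z m (coordination_rule \<psi>) (Suc t) \<omega>) (X0 m (coordination_rule \<psi>) (Suc t) \<omega>))"
    for z x0 \<gamma> u0
    by (simp add: expectation_info_cost[OF l t] expectation_info_next[OF K t] bellman_rhs_def
        distrib_left)
  finally show ?thesis
    using integrable_state[of "Suc t" v "coordination_rule \<psi>"] t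
    by (simp add: expectation_info_partition[OF t1 integrable_bellman_at[OF t], where \<psi> = \<psi>]
        expectation_info_partition[OF t1 integrable_stage_cost[OF t], where \<psi> = \<psi>]
        expectation_info_partition[OF t1 integrable_state, where \<psi> = \<psi>]
        case_prod_unfold sum.distrib)
qed

lemma V_eq_Min:
  assumes "t \<in> {1..T}"
  shows "V T l K t z x0 = Min (range (bellman_rhs l K (V T l K (Suc t)) t z x0))"
  using assms by (subst V.simps) simp

lemma value_le_cost:
  assumes l: "conditional_cost m l" and K: "conditional_law m K"
    and "1 \<le> t" "t \<le> Suc (horizon m)"
  shows "expectation (\<lambda>\<omega>. V (horizon m) l K t
      (Z m (coordination_rule \<psi>) t \<omega>) (X0 m (coordination_rule \<psi>) t \<omega>)) \<le>
    (\<Sum>s = t..horizon m. expectation (stage_cost m (coordination_rule \<psi>) s))"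
  using assms(4,3)
proof (induction t rule: inc_induct)
  case base
  show ?case by (simp add: V.simps)
next
  case (step t)
  then have t: "t \<in> {1..horizon m}" by simp
  let ?v = "V (horizon m) l K"
  have "expectation (\<lambda>\<omega>. ?v t (Z m (coordination_rule \<psi>) t \<omega>) (X0 m (coordination_rule \<psi>) t \<omega>))
      \<le> expectation (bellman_at l K (?v (Suc t)) \<psi> t)"
    using t by (intro integral_mono integrable_state integrable_bellman_at)
      (auto simp: V_eq_Min bellman_at_def)
  also have "\<dots> \<le> expectation (stage_cost m (coordination_rule \<psi>) t) +
      (\<Sum>s = Suc t..horizon m. expectation (stage_cost m (coordination_rule \<psi>) s))"
    using step bellman_step[OF l K t] by simp
  finally show ?case
    using t by (simp add: sum.atLeast_Suc_atMost)
qed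

text \<open>If minimizers are played throughout, the only inequality in the induction is an equality.\<close>

lemma value_eq_cost:
  assumes l: "conditional_cost m l" and K: "conditional_law m K"
    and arg_min: "\<And>t \<omega>. t \<in> {1..horizon m} \<Longrightarrow>
      is_arg_min (bellman_rhs l K (V (horizon m) l K (Suc t)) t
        (Z m (coordination_rule \<psi>) t \<omega>) (X0 m (coordination_rule \<psi>) t \<omega>)) (\<lambda>_. True)
        (\<Gamma> m \<psi> t \<omega>, U0 m (coordination_rule \<psi>) t \<omega>)"
    and "1 \<le> t" "t \<le> Suc (horizon m)"
  shows "expectation (\<lambda>\<omega>. V (horizon m) l K t
      (Z m (coordination_rule \<psi>) t \<omega>) (X0 m (coordination_rule \<psi>) t \<omega>)) =
    (\<Sum>s = t..horizon m. expectation (stage_cost m (coordination_rule \<psi>) s))"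
  using assms(5,4)
proof (induction t rule: inc_induct)
  case base
  show ?case by (simp add: V.simps)
next
  case (step t)
  then have t: "t \<in> {1..horizon m}" by simp
  let ?v = "V (horizon m) l K"
  have "?v t (Z m (coordination_rule \<psi>) t \<omega>) (X0 m (coordination_rule \<psi>) t \<omega>) =
      bellman_at l K (?v (Suc t)) \<psi> t \<omega>" for \<omega>
    unfolding V_eq_Min[OF t] bellman_at_def
    using arg_min[OF t, of \<omega>] by (intro Min_eqI) (auto simp: is_arg_min_linorder)
  then have "expectation (\<lambda>\<omega>. ?v t (Z m (coordination_rule \<psi>) t \<omega>) (X0 m (coordination_rule \<psi>) t \<omega>))
      = expectation (bellman_at l K (?v (Suc t)) \<psi> t)"
    by simp
  also have "\<dots> = expectation (stage_cost m (coordination_rule \<psi>) t) +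
      (\<Sum>s = Suc t..horizon m. expectation (stage_cost m (coordination_rule \<psi>) s))"
    using step bellman_step[OF l K t] by simp
  finally show ?case
    using t by (simp add: sum.atLeast_Suc_atMost)
qed

lemma J_coordination:
  assumes "control_rule \<sigma> = (coordination_rule \<psi> :: ('n, 'x, 'u, 'x0, 'u0) action_rule)"
  shows "J m \<sigma> = (\<Sum>s = 1..horizon m. expectation (stage_cost m (coordination_rule \<psi>) s))"
  unfolding J_def assms
  by (rule Bochner_Integration.integral_sum) (rule integrable_stage_cost)

text \<open>
  Lower bound and attained value coincide: both are the expectation of the value function at
  time 1, where the state is determined by the initial random variables alone.
\<close>

lemma optimal_markov_strategy:
  assumes l: "conditional_cost m l" and K: "conditional_law m K"
    and arg_min: "\<forall>t \<in> {1..horizon m}. \<forall>z \<in> range (empirical :: ('n \<Rightarrow> 'x) \<Rightarrow> 'x pmf). \<forall>x0.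
        is_arg_min (bellman_rhs l K (V (horizon m) l K (Suc t)) t z x0) (\<lambda>_. True) (\<psi> t z x0)"
  shows "optimal m (markov_strategy
    (\<lambda>t z x0. snd (\<psi> t z x0)) (\<lambda>t z x0 x. fst (\<psi> t z x0) x))"
  unfolding optimal_def
proof
  fix \<sigma> :: "('x, 'u, 'x0, 'u0) control_strategy"
  let ?\<sigma> = "markov_strategy (\<lambda>t z x0. snd (\<psi> t z x0)) (\<lambda>t z x0 x. fst (\<psi> t z x0) x)"
  \<comment> \<open>\<open>\<phi>\<close> and \<open>\<theta>\<close> are the coordination strategies that induce the action rules of \<open>\<sigma>\<close> and of
    the Markovian strategy.\<close>
  define \<phi> where "\<phi> = (\<lambda>t zs x0s. (snd \<sigma> t zs x0s, fst \<sigma> t zs x0s))"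
  define \<theta> where "\<theta> = (\<lambda>t zs x0s. \<psi> t (last zs) (last x0s))"
  have \<phi>: "control_rule \<sigma> = (coordination_rule \<phi> :: ('n, 'x, 'u, 'x0, 'u0) action_rule)"
    by (auto simp: fun_eq_iff control_rule_def coordination_rule_def \<phi>_def split: prod.splits)
  have \<theta>: "control_rule ?\<sigma> = (coordination_rule \<theta> :: ('n, 'x, 'u, 'x0, 'u0) action_rule)"
    by (auto simp: fun_eq_iff control_rule_def coordination_rule_def markov_strategy_def \<theta>_def
        split: prod.splits)
  have last: "last (Zs m a t \<omega>) = Z m a t \<omega>" "last (X0s m a t \<omega>) = X0 m a t \<omega>"
    if "t \<in> {1..horizon m}" for a t \<omega>
    using that by (auto simp: Zs_def X0s_def)
  have "(\<Gamma> m \<theta> t \<omega>, U0 m (coordination_rule \<theta>) t \<omega>) =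
      \<psi> t (Z m (coordination_rule \<theta>) t \<omega>) (X0 m (coordination_rule \<theta>) t \<omega>)"
    if "t \<in> {1..horizon m}" for t \<omega>
    unfolding \<Gamma>_def U0_def coordination_rule_def[of \<theta> t] \<theta>_def[THEN fun_cong, of t] last[OF that]
    by (simp add: case_prod_unfold Let_def)
  then have "is_arg_min (bellman_rhs l K (V (horizon m) l K (Suc t)) t
        (Z m (coordination_rule \<theta>) t \<omega>) (X0 m (coordination_rule \<theta>) t \<omega>)) (\<lambda>_. True)
        (\<Gamma> m \<theta> t \<omega>, U0 m (coordination_rule \<theta>) t \<omega>)" if "t \<in> {1..horizon m}" for t \<omega>
    using arg_min that by (simp add: Z_def)
  then have "J m ?\<sigma> = expectation (\<lambda>\<omega>. V (horizon m) l K 1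
      (Z m (coordination_rule \<theta>) 1 \<omega>) (X0 m (coordination_rule \<theta>) 1 \<omega>))"
    unfolding J_coordination[OF \<theta>] using value_eq_cost[OF l K, of \<theta> 1] by simp
  also have "\<dots> = expectation (\<lambda>\<omega>. V (horizon m) l K 1
      (Z m (coordination_rule \<phi>) 1 \<omega>) (X0 m (coordination_rule \<phi>) 1 \<omega>))"
    by (simp add: Z_def X_def X0_def)
  also have "\<dots> \<le> J m \<sigma>"
    unfolding J_coordination[OF \<phi>] by (rule value_le_cost[OF l K]) simp_all
  finally show "J m ?\<sigma> \<le> J m \<sigma>" .
qed

text \<open>
  To obtain an optimal Markovian strategy unconditionally, the dynamic program needs some
  conditional cost and law to run with.
\<close>

lemma conditional_cost_exists: "\<exists>l. conditional_cost m l"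
proof
  show "conditional_cost m (\<lambda>t z x0 \<gamma> u0. step_mean t z x0 \<gamma> u0 (\<lambda>x _ _. cost m t x x0 (\<gamma> \<circ> x) u0))"
    unfolding conditional_cost_def using conditional_expectation_of_cost by fastforce
qed

text \<open>
  Only finitely many mean fields and major states occur, so the conditional law of the next pair
  is discrete although the type of distributions is uncountable in general.
\<close>

lemma next_state_law_is_pmf:
  assumes t: "t \<in> {1..horizon m}" and \<psi>: "\<psi> \<in> realizing_strategies m t z x0 \<gamma> u0"
  shows "\<exists>p. measure_pmf p = distr (uniform_measure (sample m) (info_event m \<psi> t z x0 \<gamma> u0))
    (count_space UNIV)
    (\<lambda>\<omega>. (Z m (coordination_rule \<psi>) (Suc t) \<omega>, X0 m (coordination_rule \<psi>) (Suc t) \<omega>))"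
proof -
  let ?U = "uniform_measure (sample m) (info_event m \<psi> t z x0 \<gamma> u0)"
  let ?f = "\<lambda>\<omega>. (Z m (coordination_rule \<psi>) (Suc t) \<omega>, X0 m (coordination_rule \<psi>) (Suc t) \<omega>)"
  let ?D = "distr ?U (count_space UNIV) ?f"
  have f: "?f \<in> measurable ?U (count_space UNIV)"
    using state_measurable[of "Suc t" "coordination_rule \<psi>"] t
    by (auto simp: measurable_def uniform_measure_def)
  have "prob_space ?U"
    using \<psi> info_event_in_events[of t \<psi> z x0 \<gamma> u0] t
    by (intro prob_space_uniform_measure) (auto simp: realizing_strategies_def emeasure_eq_measure)
  then interpret D: prob_space ?D
    using f by (rule prob_space.prob_space_distr)
  have "finite (range (empirical :: ('n \<Rightarrow> 'x) \<Rightarrow> _) \<times> (UNIV :: 'x0 set))"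
    by simp
  moreover have "AE q in ?D. q \<in> range (empirical :: ('n \<Rightarrow> 'x) \<Rightarrow> _) \<times> UNIV"
    by (subst AE_distr_iff[OF f]) (auto simp: Z_def)
  ultimately have "AE q in ?D. measure ?D {q} \<noteq> 0"
    by (subst D.AE_support_countable)
      (auto intro!: exI[of _ "range (empirical :: ('n \<Rightarrow> 'x) \<Rightarrow> _) \<times> UNIV"] countable_finite)
  then show ?thesis
    using D.prob_space_axioms by (intro exI[of _ "Abs_pmf ?D"] Abs_pmf_inverse) simp
qed

lemma conditional_law_exists: "\<exists>K. conditional_law m K"
proof -
  let ?P = "\<lambda>t z x0 \<gamma> u0 p. if realizing_strategies m t z x0 \<gamma> u0 \<noteq> {}
    then \<exists>\<psi> \<in> realizing_strategies m t z x0 \<gamma> u0. measure_pmf p =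
      distr (uniform_measure (sample m) (info_event m \<psi> t z x0 \<gamma> u0)) (count_space UNIV)
        (\<lambda>\<omega>. (Z m (coordination_rule \<psi>) (Suc t) \<omega>, X0 m (coordination_rule \<psi>) (Suc t) \<omega>))
    else set_pmf p \<subseteq> range (empirical :: ('n \<Rightarrow> 'x) \<Rightarrow> 'x pmf) \<times> UNIV"
  have "\<exists>p. ?P t z x0 \<gamma> u0 p" if "t \<in> {1..horizon m}" for t z x0 \<gamma> u0
  proof (cases "realizing_strategies m t z x0 \<gamma> u0 = {}")
    case True
    then show ?thesis
      by (intro exI[of _ "return_pmf (empirical (\<lambda>_ :: 'n. undefined :: 'x), undefined)"]) simp
  next
    case False
    then obtain \<psi> where \<psi>: "\<psi> \<in> realizing_strategies m t z x0 \<gamma> u0" by blast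
    with next_state_law_is_pmf[OF that \<psi>] False show ?thesis
      by (simp only: if_True not_False_eq_True simp_thms) blast
  qed
  then have "conditional_law m (\<lambda>t z x0 \<gamma> u0. SOME p. ?P t z x0 \<gamma> u0 p)"
    unfolding conditional_law_def by (intro ballI allI) (rule someI_ex)
  then show ?thesis
    by (rule exI[of "conditional_law m"])
qed

lemma optimal_markov_strategy_exists: "\<exists>g0 g. optimal m (markov_strategy g0 g)"
proof -
  obtain l where l: "conditional_cost m l" using conditional_cost_exists ..
  obtain K where K: "conditional_law m K" using conditional_law_exists ..
  have "\<exists>q. is_arg_min (bellman_rhs l K (V (horizon m) l K (Suc t)) t z x0) (\<lambda>_. True) q" for t z x0
    using ex_is_arg_min_if_finite[of UNIV "bellman_rhs l K (V (horizon m) l K (Suc t)) t z x0"]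
    by simp
  then have "is_arg_min (bellman_rhs l K (V (horizon m) l K (Suc t)) t z x0) (\<lambda>_. True)
      (SOME q. is_arg_min (bellman_rhs l K (V (horizon m) l K (Suc t)) t z x0) (\<lambda>_. True) q)"
    for t z x0
    by (rule someI_ex)
  then have "\<exists>\<psi>. \<forall>t z x0.
      is_arg_min (bellman_rhs l K (V (horizon m) l K (Suc t)) t z x0) (\<lambda>_. True) (\<psi> t z x0)"
    by (intro exI allI)
  then obtain \<psi> where "\<And>t z x0.
      is_arg_min (bellman_rhs l K (V (horizon m) l K (Suc t)) t z x0) (\<lambda>_. True) (\<psi> t z x0)"
    by blast
  then have "optimal m (markov_strategy (\<lambda>t z x0. snd (\<psi> t z x0)) (\<lambda>t z x0 x. fst (\<psi> t z x0) x))"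
    by (intro optimal_markov_strategy[OF l K]) simp
  then show ?thesis by blast
qed

end

theorem theorem3:
  fixes m :: "('n::finite, 'x::finite, 'u::finite, 'x0::finite, 'u0::finite, 'd, 'd0, 'w) mf_mm"
  assumes "mf_mm_model m"
  shows "(\<exists>g0 g. optimal m (markov_strategy g0 g)) \<and>
    (\<forall>l K \<psi>. conditional_cost m l \<longrightarrow> conditional_law m K \<longrightarrow>
      (\<forall>t \<in> {1..horizon m}. \<forall>z \<in> range (empirical :: ('n \<Rightarrow> 'x) \<Rightarrow> 'x pmf). \<forall>x0.
        is_arg_min (bellman_rhs l K (V (horizon m) l K (Suc t)) t z x0) (\<lambda>_. True) (\<psi> t z x0)) \<longrightarrow>
      optimal m (markov_strategy
        (\<lambda>t z x0. snd (\<psi> t z x0)) (\<lambda>t z x0 x. fst (\<psi> t z x0) x)))"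
proof -
  interpret mf_mm_model m by (rule assms)
  show ?thesis
    using optimal_markov_strategy_exists optimal_markov_strategy by blast
qed

end
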